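(* Let $n\ge 2$ be an integer. Let $\mathcal M$ be a von Neumann algebra without central summands of type $I_1$, and let $\varphi:\mathcal M\to\mathcal M$ be a map (not assumed additive) that preserves complex scalar multiplication. Then $\varphi$ is a bijective unital multiplicative $*$-Lie $n$-map if and only if $\varphi$ is a $*$-isomorphism.
   Context: A von Neumann algebra is a weakly closed self-adjoint algebra of operators on a Hilbert space containing the identity operator $I$. For elements $x,y$ of a $*$-algebra, $[x,y]_*=xy-yx^*$. The polynomials $p_{n_*}$ are defined by $p_{1_*}(x)=x$ and $p_{n_*}(x_1,\ldots,x_n)=[p_{(n-1)_*}(x_1,\ldots,x_{n-1}),x_n]_*$ for $n\ge 2$. A map $\varphi$ (not necessarily additive) is a multiplicative $*$-Lie $n$-map if $\varphi(p_{n_*}(x_1,\ldots,x_n))=p_{n_*}(\varphi(x_1),\ldots,\varphi(x_n))$ for all $x_1,\ldots,x_n$ in its domain. Unital means $\varphi(I)=I$. Preserving complex scalar multiplication means $\varphi(\lambda A)=\lambda\varphi(A)$ for all $\lambda\in\mathbb C$, $A\in\mathcal M$. A $*$-isomorphism is a bijective complex-linear multiplicative map preserving $*$. *)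

theory Defs
  imports "HOL-Analysis.Analysis"
begin

class scaleC =
  fixes scaleC :: "complex \<Rightarrow> 'a \<Rightarrow> 'a"  (infixr \<open>*\<^sub>C\<close> 75)

class complex_vector = scaleC + ab_group_add +
  assumes scaleC_add_right: "c *\<^sub>C (x + y) = c *\<^sub>C x + c *\<^sub>C y"
    and scaleC_add_left: "(c + d) *\<^sub>C x = c *\<^sub>C x + d *\<^sub>C x"
    and scaleC_scaleC: "c *\<^sub>C d *\<^sub>C x = (c * d) *\<^sub>C x"
    and scaleC_one: "1 *\<^sub>C x = x"

text \<open>
  The complex inner product is linear in its first argument. Its real part is the inner product
  of the underlying real space, so positive definiteness, the norm and completeness are those
  of \<^class>\<open>real_inner\<close> and \<^class>\<open>complete_space\<close>. The zero space and non-separable spaces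
  are included.
\<close>

class complex_hilbert_space = complex_vector + real_inner + complete_space +
  fixes cinner :: "'a \<Rightarrow> 'a \<Rightarrow> complex"
  assumes scaleR_scaleC: "r *\<^sub>R x = complex_of_real r *\<^sub>C x"
    and cinner_commute: "cinner x y = cnj (cinner y x)"
    and cinner_add_left: "cinner (x + y) z = cinner x z + cinner y z"
    and cinner_scaleC_left: "cinner (c *\<^sub>C x) y = c * cinner x y"
    and inner_cinner: "inner x y = Re (cinner x y)"

lemma bounded_linear_scaleC:
  "bounded_linear (scaleC c :: 'a::complex_hilbert_space \<Rightarrow> 'a)"
proof (rule bounded_linear_intro[where K = "cmod c"])
  fix x y :: 'a and r :: real
  show "c *\<^sub>C (x + y) = c *\<^sub>C x + c *\<^sub>C y"
    by (rule scaleC_add_right)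
  show "c *\<^sub>C (r *\<^sub>R x) = r *\<^sub>R (c *\<^sub>C x)"
    by (simp add: scaleR_scaleC scaleC_scaleC mult.commute)
  have "cinner (c *\<^sub>C x) (c *\<^sub>C x) = c * cnj c * cinner x x"
    by (metis cinner_commute cinner_scaleC_left complex_cnj_mult mult.assoc)
  then have "inner (c *\<^sub>C x) (c *\<^sub>C x) = (cmod c)\<^sup>2 * inner x x"
    by (simp add: inner_cinner flip: complex_norm_square of_real_power)
  then show "norm (c *\<^sub>C x) \<le> norm x * cmod c"
    by (simp add: norm_eq_sqrt_inner real_sqrt_mult)
qed

typedef (overloaded) 'a bounded_op =
  "{A :: 'a::complex_hilbert_space \<Rightarrow> 'a. bounded_linear A \<and> (\<forall>c x. A (c *\<^sub>C x) = c *\<^sub>C A x)}"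
  morphisms op_apply Bounded_op
  by (rule exI[of _ id]) (simp add: bounded_linear_ident id_def)

setup_lifting type_definition_bounded_op

instantiation bounded_op :: (complex_hilbert_space) "{ring, monoid_mult, complex_vector}"
begin

lift_definition zero_bounded_op :: "'a bounded_op" is "\<lambda>x. 0"
  by (metis (mono_tags) bounded_linear_zero bounded_linear_scaleC linear_0 bounded_linear.linear)

lift_definition one_bounded_op :: "'a bounded_op" is "\<lambda>x. x"
  by (simp add: bounded_linear_ident)

lift_definition plus_bounded_op :: "'a bounded_op \<Rightarrow> 'a bounded_op \<Rightarrow> 'a bounded_op"
  is "\<lambda>A B x. A x + B x"
  by (simp add: bounded_linear_add scaleC_add_right)

lift_definition uminus_bounded_op :: "'a bounded_op \<Rightarrow> 'a bounded_op"
  is "\<lambda>A x. - A x"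
  by (simp add: bounded_linear_minus linear_neg[OF bounded_linear.linear[OF bounded_linear_scaleC]])

lift_definition minus_bounded_op :: "'a bounded_op \<Rightarrow> 'a bounded_op \<Rightarrow> 'a bounded_op"
  is "\<lambda>A B x. A x - B x"
  by (simp add: bounded_linear_sub linear_diff[OF bounded_linear.linear[OF bounded_linear_scaleC]])

lift_definition times_bounded_op :: "'a bounded_op \<Rightarrow> 'a bounded_op \<Rightarrow> 'a bounded_op"
  is "\<lambda>A B x. A (B x)"
  by (simp add: bounded_linear_compose)

lift_definition scaleC_bounded_op :: "complex \<Rightarrow> 'a bounded_op \<Rightarrow> 'a bounded_op"
  is "\<lambda>c A x. c *\<^sub>C A x"
  by (simp add: bounded_linear_compose[OF bounded_linear_scaleC] scaleC_scaleC mult.commute)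

instance
  by standard
    (transfer; simp add: fun_eq_iff scaleC_add_right scaleC_add_left scaleC_scaleC scaleC_one
      linear_add[OF bounded_linear.linear] algebra_simps)+

end

text \<open>By the Riesz representation theorem the operator described here exists.\<close>

definition adj :: "'a::complex_hilbert_space bounded_op \<Rightarrow> 'a bounded_op"
  where "adj A = (THE B. \<forall>x y. cinner (op_apply A x) y = cinner x (op_apply B y))"

text \<open>The coarsest topology making all maps \<open>A \<mapsto> \<langle>A x, y\<rangle>\<close> continuous.\<close>

definition weak_operator_topology :: "'a::complex_hilbert_space bounded_op topology"
  where "weak_operator_topology =
    pullback_topology UNIV (\<lambda>A (x, y). cinner (op_apply A x) y) euclidean"

definition von_neumann_algebra :: "'a::complex_hilbert_space bounded_op set \<Rightarrow> bool"
  where "von_neumann_algebra M \<longleftrightarrow>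
    1 \<in> M \<and>
    (\<forall>A\<in>M. \<forall>B\<in>M. A + B \<in> M) \<and>
    (\<forall>c. \<forall>A\<in>M. c *\<^sub>C A \<in> M) \<and>
    (\<forall>A\<in>M. \<forall>B\<in>M. A * B \<in> M) \<and>
    (\<forall>A\<in>M. adj A \<in> M) \<and>
    closedin weak_operator_topology M"

definition projection :: "'a::complex_hilbert_space bounded_op \<Rightarrow> bool"
  where "projection P \<longleftrightarrow> P * P = P \<and> adj P = P"

definition central_projection ::
    "'a::complex_hilbert_space bounded_op set \<Rightarrow> 'a bounded_op \<Rightarrow> bool"
  where "central_projection M P \<longleftrightarrow> P \<in> M \<and> projection P \<and> (\<forall>A\<in>M. A * P = P * A)"

definition abelian_projection ::
    "'a::complex_hilbert_space bounded_op set \<Rightarrow> 'a bounded_op \<Rightarrow> bool"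
  where "abelian_projection M E \<longleftrightarrow> E \<in> M \<and> projection E \<and>
    (\<forall>A\<in>M. \<forall>B\<in>M. (E * A * E) * (E * B * E) = (E * B * E) * (E * A * E))"

definition equivalent_projections ::
    "'a::complex_hilbert_space bounded_op set \<Rightarrow> 'a bounded_op \<Rightarrow> 'a bounded_op \<Rightarrow> bool"
  where "equivalent_projections M E F \<longleftrightarrow> (\<exists>V\<in>M. adj V * V = E \<and> V * adj V = F)"

text \<open>
  Here \<open>M\<close> is a von Neumann algebra whose unit \<open>e\<close> may be a proper projection, as is the case for
  a central summand, which is viewed as acting on the range of \<open>e\<close>. Type \<open>I\<^sub>n\<close> means that the unit
  is a sum of \<open>n\<close> orthogonal equivalent abelian projections; in particular, type \<open>I\<^sub>1\<close> means
  that \<open>M\<close> is abelian.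
\<close>

definition type_I ::
    "nat \<Rightarrow> 'a::complex_hilbert_space bounded_op set \<Rightarrow> 'a bounded_op \<Rightarrow> bool"
  where "type_I n M e \<longleftrightarrow> (\<exists>E :: nat \<Rightarrow> 'a bounded_op.
    (\<forall>i<n. abelian_projection M (E i)) \<and>
    (\<forall>i<n. \<forall>j<n. equivalent_projections M (E i) (E j)) \<and>
    (\<forall>i<n. \<forall>j<n. i \<noteq> j \<longrightarrow> E i * E j = 0) \<and>
    (\<Sum>i<n. E i) = e)"

definition has_central_summand_type_I ::
    "nat \<Rightarrow> 'a::complex_hilbert_space bounded_op set \<Rightarrow> bool"
  where "has_central_summand_type_I n M \<longleftrightarrow>
    (\<exists>P. P \<noteq> 0 \<and> central_projection M P \<and> type_I n {A * P |A. A \<in> M} P)"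

definition star_commutator ::
    "'a::complex_hilbert_space bounded_op \<Rightarrow> 'a bounded_op \<Rightarrow> 'a bounded_op"
  where "star_commutator x y = x * y - y * adj x"

text \<open>The variables are \<open>x 1, \<dots>, x n\<close>; the value for \<open>n = 0\<close> is a dummy.\<close>

fun star_lie_poly ::
    "nat \<Rightarrow> (nat \<Rightarrow> 'a::complex_hilbert_space bounded_op) \<Rightarrow> 'a bounded_op"
  where
    "star_lie_poly 0 x = 0"
  | "star_lie_poly (Suc 0) x = x 1"
  | "star_lie_poly (Suc (Suc n)) x = star_commutator (star_lie_poly (Suc n) x) (x (Suc (Suc n)))"

definition multiplicative_star_lie_map ::
    "nat \<Rightarrow> 'a::complex_hilbert_space bounded_op set \<Rightarrow> ('a bounded_op \<Rightarrow> 'a bounded_op) \<Rightarrow> bool"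
  where "multiplicative_star_lie_map n M \<phi> \<longleftrightarrow>
    (\<forall>x. (\<forall>i\<in>{1..n}. x i \<in> M) \<longrightarrow>
      \<phi> (star_lie_poly n x) = star_lie_poly n (\<lambda>i. \<phi> (x i)))"

definition preserves_complex_scaling ::
    "'a::complex_hilbert_space bounded_op set \<Rightarrow> ('a bounded_op \<Rightarrow> 'a bounded_op) \<Rightarrow> bool"
  where "preserves_complex_scaling M \<phi> \<longleftrightarrow> (\<forall>c. \<forall>A\<in>M. \<phi> (c *\<^sub>C A) = c *\<^sub>C \<phi> A)"

definition star_isomorphism ::
    "'a::complex_hilbert_space bounded_op set \<Rightarrow> 'a bounded_op set \<Rightarrow>
      ('a bounded_op \<Rightarrow> 'a bounded_op) \<Rightarrow> bool"
  where "star_isomorphism M N \<phi> \<longleftrightarrow>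
    bij_betw \<phi> M N \<and>
    (\<forall>A\<in>M. \<forall>B\<in>M. \<phi> (A + B) = \<phi> A + \<phi> B) \<and>
    (\<forall>c. \<forall>A\<in>M. \<phi> (c *\<^sub>C A) = c *\<^sub>C \<phi> A) \<and>
    (\<forall>A\<in>M. \<forall>B\<in>M. \<phi> (A * B) = \<phi> A * \<phi> B) \<and>
    (\<forall>A\<in>M. \<phi> (adj A) = adj (\<phi> A))"

end

theory Submission
  imports Defs
begin

text \<open>
  A star-isomorphism clearly respects the star-Lie polynomials. For the converse, substituting \<open>\<i>\<close>
  and \<open>1\<close> for the first variables reduces the identity to two variables, and homogeneity gives it
  also with the opposite sign: \<open>\<phi>\<close> respects both \<open>x y - y x\<^sup>*\<close> and \<open>x y + y x\<^sup>*\<close>. With \<open>y = 1\<close> this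
  shows that \<open>\<phi>\<close> preserves the involution and the decomposition into self-adjoint and skew parts.
  If \<open>\<phi>\<close> is additive, adding the two identities shows that \<open>\<phi>\<close> is multiplicative. So the whole
  problem is additivity, and it suffices to consider the defect
  \<open>d = \<phi> (u + v) - \<phi> u - \<phi> v\<close> for self-adjoint \<open>u\<close> and \<open>v\<close>.

  Let \<open>j\<close> be a symmetry, that is, \<open>j = 2 p - 1\<close> for a projection \<open>p\<close>, and take the Peirce decomposition
  into elements that commute and that anticommute with \<open>j\<close>. The two product identities make \<open>\<phi>\<close>
  additive across the two parts and on the anticommuting part. Multiplying a commuting element by an
  anticommuting one then shows that \<open>d\<close> annihilates every element that anticommutes with \<open>k = \<phi> j\<close>;
  in particular \<open>d (k A - A k) = 0\<close> for all \<open>A\<close> (lemma \<open>symmetry_defect\<close>). Since \<open>\<phi>\<close> permutes the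
  symmetries, \<open>k\<close> is an arbitrary symmetry of \<open>M\<close>.

  Unlike in the usual argument, no single projection with central carrier \<open>1\<close> for itself and its
  complement has to be constructed. Instead all projections are used at once. A von Neumann algebra
  contains the sign \<open>S\<close> of each of its self-adjoint elements, which is a difference of orthogonal
  projections; it is obtained as the strong limit of Newton iterates (lemma \<open>sign_exists\<close>). A halving
  argument based on it extends \<open>d (k A - A k) = 0\<close> from symmetries to \<open>d (B A - A B) = 0\<close> for all
  \<open>A\<close> and \<open>B\<close> (lemma \<open>commutator_annihilates_of_symmetries\<close>). Finally, if \<open>d\<close> were nonzero, then the
  square of its sign would be a nonzero central projection \<open>P\<close> with \<open>M P\<close> abelian, a central summand of
  type \<open>I\<^sub>1\<close> (lemma \<open>commutator_annihilator_trivial\<close>).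
\<close>

section \<open>Complex Hilbert spaces and the adjoint\<close>

interpretation scaleC: vector_space "scaleC :: complex \<Rightarrow> 'a \<Rightarrow> 'a::complex_vector"
  by standard (simp_all add: scaleC_add_right scaleC_add_left scaleC_scaleC scaleC_one)

lemma cinner_add_right: "cinner x (y + z) = cinner x y + cinner x z"
  by (metis cinner_add_left cinner_commute complex_cnj_add)

lemma cinner_scaleC_right: "cinner x (c *\<^sub>C y) = cnj c * cinner x y"
  by (metis cinner_commute cinner_scaleC_left complex_cnj_mult)

lemma cinner_diff_left: "cinner (x - y) z = cinner x z - cinner y z"
  by (metis add_diff_cancel diff_add_cancel cinner_add_left)

lemma cinner_diff_right: "cinner x (y - z) = cinner x y - cinner x z"
  by (metis add_diff_cancel diff_add_cancel cinner_add_right)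

lemma cinner_eq_inner: "cinner x y = Complex (inner x y) (inner x (\<i> *\<^sub>C y))"
  by (simp add: complex_eq_iff inner_cinner cinner_scaleC_right)

lemma tendsto_cinner_left:
  assumes "(f \<longlongrightarrow> a) F"
  shows "((\<lambda>n. cinner (f n) y) \<longlongrightarrow> cinner a y) F"
  unfolding cinner_eq_inner by (intro tendsto_Complex tendsto_inner assms tendsto_const)

lemma cinner_ext: "(\<And>x. cinner x y = cinner x z) \<Longrightarrow> y = z"
  by (metis inner_cinner vector_eq_ldot)

text \<open>
  A minimiser \<open>y\<close> of \<open>\<langle>x, x\<rangle> - 2 f x\<close> represents \<open>f\<close>, because the derivative at \<open>y\<close> in every
  direction vanishes. A minimising sequence is Cauchy by the parallelogram law.
\<close>

lemma riesz_representation_real: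
  fixes f :: "'a::{real_inner, complete_space} \<Rightarrow> real"
  assumes "bounded_linear f"
  shows "\<exists>y. \<forall>x. f x = inner y x"
proof -
  interpret f: bounded_linear f by fact
  define g where "g x = inner x x - 2 * f x" for x
  obtain K where K: "K > 0" "\<And>x. norm (f x) \<le> norm x * K"
    using f.pos_bounded by blast
  have lower: "- K\<^sup>2 \<le> g x" for x
  proof -
    have "f x \<le> norm x * K"
      using K(2)[of x] by simp
    moreover have "0 \<le> (norm x - K)\<^sup>2"
      by simp
    ultimately show ?thesis
      unfolding g_def by (simp add: power2_diff dot_square_norm)
  qed
  define m where "m = Inf (range g)"
  have m: "m \<le> g x" for x
    unfolding m_def by (rule cInf_lower) (auto intro!: bdd_belowI2 lower)
  have "\<exists>x. g x < m + 1 / Suc n" for n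
    using cInf_lessD[of "range g" "m + 1 / Suc n"] unfolding m_def by auto
  then obtain s where s: "\<And>n. g (s n) < m + 1 / Suc n"
    by metis
  have gap: "(norm (s i - s j))\<^sup>2 \<le> 2 / Suc i + 2 / Suc j" for i j
  proof -
    \<comment> \<open>The parallelogram law, with the midpoint bounded below by the infimum \<open>m\<close>.\<close>
    have "4 * m \<le> 4 * g ((1/2) *\<^sub>R (s i + s j))"
      using m by simp
    also have "\<dots> = 2 * g (s i) + 2 * g (s j) - (norm (s i - s j))\<^sup>2"
      unfolding g_def by (simp add: f.scaleR f.add power2_norm_eq_inner algebra_simps inner_commute)
    finally show ?thesis
      using s[of i] s[of j] by simp
  qed
  have "Cauchy s"
  proof (rule metric_CauchyI)
    fix e :: real assume "e > 0"
    then obtain N where N: "4 / e\<^sup>2 < real N"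
      using reals_Archimedean2 by blast
    have "dist (s i) (s j) < e" if "i \<ge> N" "j \<ge> N" for i j
    proof -
      have "2 / Suc i \<le> 2 / Suc N" "2 / Suc j \<le> 2 / Suc N"
        using that by (auto intro!: divide_left_mono)
      then have "(norm (s i - s j))\<^sup>2 \<le> 4 / Suc N"
        using gap[of i j] by simp
      also have "\<dots> < e\<^sup>2"
        using N \<open>e > 0\<close> by (simp add: field_simps add_strict_increasing)
      finally show ?thesis
        using \<open>e > 0\<close> by (simp add: dist_norm power2_less_imp_less)
    qed
    then show "\<exists>N. \<forall>i\<ge>N. \<forall>j\<ge>N. dist (s i) (s j) < e"
      by blast
  qed
  then obtain y where y: "s \<longlonglongrightarrow> y"
    using Cauchy_convergent_iff convergent_def by blast
  have "(\<lambda>n. g (s n)) \<longlonglongrightarrow> g y"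
    unfolding g_def by (intro tendsto_intros y f.tendsto)
  moreover have "(\<lambda>n. m + 1 / Suc n) \<longlonglongrightarrow> m + 0"
    by (intro tendsto_intros lim_1_over_n[THEN LIMSEQ_Suc])
  ultimately have "g y \<le> m + 0"
    by (rule LIMSEQ_le) (blast intro: less_imp_le s)
  then have gy: "g y \<le> m"
    by simp
  have "f x = inner y x" for x
  proof (rule ccontr)
    define b where "b = f x - inner y x"
    assume "f x \<noteq> inner y x"
    then have b: "b \<noteq> 0" and "x \<noteq> 0"
      by (auto simp: b_def)
    \<comment> \<open>This \<open>t\<close> minimises \<open>g (y + t *\<^sub>R x)\<close>.\<close>
    define t where "t = b / inner x x"
    have x: "inner x x > 0"
      using \<open>x \<noteq> 0\<close> by simp
    have "g y \<le> g (y + t *\<^sub>R x)"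
      using gy m order_trans by blast
    then have "2 * t * b \<le> t\<^sup>2 * inner x x"
      unfolding g_def b_def
      by (simp add: f.scaleR f.add algebra_simps inner_commute power2_eq_square)
    then have "b\<^sup>2 \<le> 0"
      using x by (simp add: t_def field_simps power2_eq_square)
    then show False
      using b by simp
  qed
  then show ?thesis
    by blast
qed

lemma op_apply_bounded_linear: "bounded_linear (op_apply A)"
  using op_apply[of A] by simp

lemma op_apply_scaleC: "op_apply A (c *\<^sub>C x) = c *\<^sub>C op_apply A x"
  using op_apply[of A] by simp

lemmas op_apply_linear_simps =
  linear_add[OF bounded_linear.linear[OF op_apply_bounded_linear]]
  linear_diff[OF bounded_linear.linear[OF op_apply_bounded_linear]]
  linear_0[OF bounded_linear.linear[OF op_apply_bounded_linear]]
  op_apply_scaleC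

lemmas op_apply_simps [simp] =
  zero_bounded_op.rep_eq one_bounded_op.rep_eq plus_bounded_op.rep_eq uminus_bounded_op.rep_eq
  minus_bounded_op.rep_eq times_bounded_op.rep_eq scaleC_bounded_op.rep_eq

lemma op_eqI: "(\<And>x. op_apply A x = op_apply B x) \<Longrightarrow> A = B"
  by (simp add: op_apply_inject[symmetric] fun_eq_iff)

lemma mult_scaleC_left [simp]: "(c *\<^sub>C A) * B = c *\<^sub>C (A * B :: 'a::complex_hilbert_space bounded_op)"
  by (rule op_eqI) simp

lemma mult_scaleC_right [simp]: "A * (c *\<^sub>C B) = c *\<^sub>C (A * B :: 'a::complex_hilbert_space bounded_op)"
  by (rule op_eqI) (simp add: op_apply_scaleC)

lemma op_apply_bound: "\<exists>K>0. \<forall>x. norm (op_apply A x) \<le> K * norm x"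
  using bounded_linear.pos_bounded[OF op_apply_bounded_linear[of A]] by (simp add: mult.commute)

text \<open>
  Riesz for the real functional \<open>x \<mapsto> Re \<langle>A x, y\<rangle>\<close> yields the value of the adjoint at \<open>y\<close>; its
  imaginary counterpart is the same identity at \<open>\<i> x\<close>.
\<close>

lemma adjoint_exists:
  fixes A :: "'a::complex_hilbert_space bounded_op"
  shows "\<exists>B. \<forall>x y. cinner (op_apply A x) y = cinner x (op_apply B y)"
proof -
  have "\<exists>z. \<forall>x. cinner (op_apply A x) y = cinner x z" for y
  proof -
    have "bounded_linear (\<lambda>x. inner (op_apply A x) y)"
      by (rule bounded_linear_inner_left_comp[OF op_apply_bounded_linear])
    then obtain z where z: "\<And>x. inner (op_apply A x) y = inner z x"
      using riesz_representation_real by blast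
    have "cinner (op_apply A x) y = cinner x z" for x
    proof (rule complex_eqI)
      show "Re (cinner (op_apply A x) y) = Re (cinner x z)"
        using z[of x] by (metis inner_cinner inner_commute)
      have "Re (cinner (op_apply A (\<i> *\<^sub>C x)) y) = Re (cinner (\<i> *\<^sub>C x) z)"
        using z[of "\<i> *\<^sub>C x"] by (metis inner_cinner inner_commute)
      then show "Im (cinner (op_apply A x) y) = Im (cinner x z)"
        by (simp add: op_apply_scaleC cinner_scaleC_left)
    qed
    then show ?thesis
      by blast
  qed
  then obtain b where b: "\<And>x y. cinner (op_apply A x) y = cinner x (b y)"
    by metis
  obtain K where K: "K > 0" "\<And>x. norm (op_apply A x) \<le> K * norm x"
    using op_apply_bound[of A] by auto
  have scale: "b (c *\<^sub>C y) = c *\<^sub>C b y" for c y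
    by (rule cinner_ext) (simp add: cinner_scaleC_right flip: b)
  have "bounded_linear b"
  proof (rule bounded_linear_intro[where K = K])
    fix x y :: 'a and r :: real
    show "b (x + y) = b x + b y"
      by (rule cinner_ext) (simp add: cinner_add_right flip: b)
    show "b (r *\<^sub>R x) = r *\<^sub>R b x"
      by (simp add: scaleR_scaleC scale)
    have "(norm (b x))\<^sup>2 = inner (op_apply A (b x)) x"
      by (simp add: power2_norm_eq_inner inner_cinner b)
    also have "\<dots> \<le> norm (op_apply A (b x)) * norm x"
      by (rule norm_cauchy_schwarz)
    also have "\<dots> \<le> (K * norm (b x)) * norm x"
      by (intro mult_right_mono K) simp
    finally show "norm (b x) \<le> norm x * K"
      by (cases "b x = 0") (use K in \<open>auto simp: power2_eq_square mult_ac\<close>)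
  qed
  then have "op_apply (Bounded_op b) = b"
    by (intro Bounded_op_inverse) (simp add: scale)
  then show ?thesis
    using b by metis
qed

lemma cinner_adj: "cinner (op_apply A x) y = cinner x (op_apply (adj A) y)"
proof -
  obtain B where B: "\<forall>x y. cinner (op_apply A x) y = cinner x (op_apply B y)"
    using adjoint_exists by blast
  have "C = B" if "\<forall>x y. cinner (op_apply A x) y = cinner x (op_apply C y)" for C
    by (rule op_eqI, rule cinner_ext) (metis B that)
  then have "adj A = B"
    unfolding adj_def using B by (intro the_equality) blast+
  then show ?thesis
    using B by simp
qed

lemma adj_eqI:
  assumes "\<And>x y. cinner (op_apply A x) y = cinner x (op_apply B y)"
  shows "adj A = B"
  by (rule op_eqI, rule cinner_ext) (simp add: assms flip: cinner_adj)

lemma adj_adj [simp]: "adj (adj A) = A"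
  by (rule adj_eqI) (metis cinner_adj cinner_commute)

lemma adj_mult [simp]: "adj (A * B) = adj B * adj A"
  by (rule adj_eqI) (simp add: cinner_adj)

lemma adj_add [simp]: "adj (A + B) = adj A + adj B"
  by (rule adj_eqI) (simp add: cinner_adj cinner_add_left cinner_add_right)

lemma adj_diff [simp]: "adj (A - B) = adj A - adj B"
  by (rule adj_eqI) (simp add: cinner_adj cinner_diff_left cinner_diff_right)

lemma adj_scaleC [simp]: "adj (c *\<^sub>C A) = cnj c *\<^sub>C adj A"
  by (rule adj_eqI) (simp add: cinner_adj cinner_scaleC_left cinner_scaleC_right)

lemma adj_one [simp]: "adj 1 = 1"
  by (rule adj_eqI) simp

lemma adj_zero [simp]: "adj 0 = 0"
  using adj_diff[of 0 0] by simp

lemma adj_minus [simp]: "adj (- A) = - adj A"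
  using adj_diff[of 0 A] by simp

lemma inner_self_adjoint:
  "adj A = A \<Longrightarrow> inner (op_apply A x) y = inner x (op_apply A y)"
  by (simp add: inner_cinner cinner_adj)

lemma adj_mult_self_eq_0:
  assumes "adj A * A = 0"
  shows "A = 0"
proof (rule op_eqI)
  fix x
  have "inner (op_apply A x) (op_apply A x) = inner x (op_apply (adj A * A) x)"
    by (simp add: inner_cinner cinner_adj)
  then show "op_apply A x = op_apply 0 x"
    using assms by simp
qed

text \<open>
  Pointwise norm convergence implies convergence of all \<open>\<langle>A x, y\<rangle>\<close>, hence convergence in the weak
  operator topology. Sequences suffice below, so nets never enter.
\<close>

lemma von_neumann_algebra_strong_limit:
  fixes M :: "'a::complex_hilbert_space bounded_op set"
  assumes "von_neumann_algebra M" "\<And>n. A n \<in> M"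
    and lim: "\<And>x. (\<lambda>n. op_apply (A n) x) \<longlonglongrightarrow> op_apply B x"
  shows "B \<in> M"
proof -
  define F :: "'a bounded_op \<Rightarrow> 'a \<times> 'a \<Rightarrow> complex"
    where "F = (\<lambda>A (x, y). cinner (op_apply A x) y)"
  have "closedin weak_operator_topology M"
    using assms(1) by (simp add: von_neumann_algebra_def)
  then have "openin (pullback_topology UNIV F euclidean) (- M)"
    unfolding weak_operator_topology_def F_def closedin_def
    by (simp add: topspace_pullback_topology Compl_eq_Diff_UNIV)
  then obtain U where U: "open U" "- M = F -` U"
    by (auto simp: openin_pullback_topology)
  have "(\<lambda>n. F (A n)) \<longlonglongrightarrow> F B"
    unfolding limitin_canonical_iff[symmetric] euclidean_product_topology[symmetric]
      limitin_componentwise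
    by (auto simp: F_def intro!: tendsto_cinner_left lim)
  then have "F B \<in> U \<Longrightarrow> \<forall>\<^sub>F n in sequentially. F (A n) \<in> U"
    using U(1) topological_tendstoD by blast
  then have "F B \<notin> U"
    using U(2) assms(2) by (auto simp: eventually_sequentially)
  then show ?thesis
    using U(2) by blast
qed

section \<open>Von Neumann algebras and the sign of a self-adjoint element\<close>

lemma von_neumann_algebra_closed:
  assumes "von_neumann_algebra M"
  shows "1 \<in> M" "0 \<in> M"
    and "A \<in> M \<Longrightarrow> B \<in> M \<Longrightarrow> A + B \<in> M"
    and "A \<in> M \<Longrightarrow> B \<in> M \<Longrightarrow> A - B \<in> M"
    and "A \<in> M \<Longrightarrow> B \<in> M \<Longrightarrow> A * B \<in> M"
    and "A \<in> M \<Longrightarrow> c *\<^sub>C A \<in> M"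
    and "A \<in> M \<Longrightarrow> adj A \<in> M"
    and "A \<in> M \<Longrightarrow> - A \<in> M"
proof -
  show one: "1 \<in> M" and add: "\<And>A B. A \<in> M \<Longrightarrow> B \<in> M \<Longrightarrow> A + B \<in> M"
    and scale: "\<And>c A. A \<in> M \<Longrightarrow> c *\<^sub>C A \<in> M"
    and "A \<in> M \<Longrightarrow> B \<in> M \<Longrightarrow> A * B \<in> M" "A \<in> M \<Longrightarrow> adj A \<in> M"
    using assms by (auto simp: von_neumann_algebra_def)
  show "0 \<in> M"
    using scale[OF one, of 0] by simp
  show "- A \<in> M" if "A \<in> M"
    using scale[OF that, of "- 1"] by (simp add: scaleC_one)
  show "A - B \<in> M" if "A \<in> M" "B \<in> M"
    using add[OF that(1) scale[OF that(2), of "- 1"]] by (simp add: scaleC_one)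
qed

lemma add_self_eq_scaleC: "X + X = 2 *\<^sub>C (X :: 'a::complex_vector)"
  by (metis one_add_one scaleC_add_left scaleC_one)

lemma half_scaleC_add_self: "(1/2) *\<^sub>C X + (1/2) *\<^sub>C X = (X :: 'a::complex_vector)"
  by (simp add: scaleC_one flip: scaleC_add_left)

definition contraction :: "'a::complex_hilbert_space bounded_op \<Rightarrow> bool"
  where "contraction A \<longleftrightarrow> (\<forall>x. norm (op_apply A x) \<le> norm x)"

definition positive_op :: "'a::complex_hilbert_space bounded_op \<Rightarrow> bool"
  where "positive_op A \<longleftrightarrow> (\<forall>x. 0 \<le> inner (op_apply A x) x)"

definition strongly_tends_to ::
    "(nat \<Rightarrow> 'a::complex_hilbert_space bounded_op) \<Rightarrow> 'a bounded_op \<Rightarrow> bool"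
  where "strongly_tends_to A B \<longleftrightarrow> (\<forall>x. (\<lambda>n. op_apply (A n) x) \<longlonglongrightarrow> op_apply B x)"

lemma strong_limit_exists:
  assumes "\<And>n. contraction (A n)" "\<And>x. Cauchy (\<lambda>n. op_apply (A n) x)"
  obtains B where "strongly_tends_to A B"
proof -
  obtain b where b: "\<And>x. (\<lambda>n. op_apply (A n) x) \<longlonglongrightarrow> b x"
    using assms(2) unfolding Cauchy_convergent_iff convergent_def by (rule that[OF someI_ex])
  have scale: "b (c *\<^sub>C x) = c *\<^sub>C b x" for c x
    using b[of "c *\<^sub>C x"] bounded_linear.tendsto[OF bounded_linear_scaleC b[of x]]
    by (auto simp: op_apply_scaleC intro: LIMSEQ_unique)
  have "bounded_linear b"
  proof (rule bounded_linear_intro[where K = 1])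
    fix x y :: 'a and r :: real
    show "b (x + y) = b x + b y"
      using b[of "x + y"] tendsto_add[OF b[of x] b[of y]]
      by (auto simp: op_apply_linear_simps intro: LIMSEQ_unique)
    show "b (r *\<^sub>R x) = r *\<^sub>R b x"
      by (simp add: scaleR_scaleC scale)
    show "norm (b x) \<le> norm x * 1"
      using assms(1) by (intro Lim_bounded[OF tendsto_norm[OF b]]) (simp add: contraction_def)
  qed
  then have "op_apply (Bounded_op b) = b"
    by (intro Bounded_op_inverse) (simp add: scale)
  then show thesis
    by (intro that[of "Bounded_op b"]) (simp add: strongly_tends_to_def b)
qed

text \<open>
  Since the left factors are contractions, \<open>A n (B n x)\<close> differs from \<open>A n (B' x)\<close> by at most
  \<open>\<parallel>B n x - B' x\<parallel>\<close>.
\<close>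

lemma strongly_tends_to_mult:
  assumes "strongly_tends_to A A'" "strongly_tends_to B B'" "\<And>n. contraction (A n)"
  shows "strongly_tends_to (\<lambda>n. A n * B n) (A' * B')"
  unfolding strongly_tends_to_def
proof
  fix x
  have "(\<lambda>n. op_apply (A n) (op_apply (B n) x - op_apply B' x)) \<longlonglongrightarrow> 0"
  proof (rule Lim_null_comparison)
    show "(\<lambda>n. norm (op_apply (B n) x - op_apply B' x)) \<longlonglongrightarrow> 0"
      using assms(2) by (intro tendsto_norm_zero) (simp add: strongly_tends_to_def LIM_zero)
    show "\<forall>\<^sub>F n in sequentially.
        norm (op_apply (A n) (op_apply (B n) x - op_apply B' x)) \<le> norm (op_apply (B n) x - op_apply B' x)"
      using assms(3) by (simp add: contraction_def)
  qed
  moreover have "(\<lambda>n. op_apply (A n) (op_apply B' x)) \<longlonglongrightarrow> op_apply A' (op_apply B' x)"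
    using assms(1) by (simp add: strongly_tends_to_def)
  ultimately have "(\<lambda>n. op_apply (A n) (op_apply (B n) x - op_apply B' x) + op_apply (A n) (op_apply B' x))
      \<longlonglongrightarrow> 0 + op_apply A' (op_apply B' x)"
    by (rule tendsto_add)
  then show "(\<lambda>n. op_apply (A n * B n) x) \<longlonglongrightarrow> op_apply (A' * B') x"
    by (simp add: op_apply_linear_simps)
qed

lemma strongly_tends_to_unique:
  "strongly_tends_to A B \<Longrightarrow> strongly_tends_to A C \<Longrightarrow> B = C"
  unfolding strongly_tends_to_def by (metis LIMSEQ_unique op_eqI)

lemma strongly_tends_to_add:
  "strongly_tends_to A A' \<Longrightarrow> strongly_tends_to B B' \<Longrightarrow> strongly_tends_to (\<lambda>n. A n + B n) (A' + B')"
  by (simp add: strongly_tends_to_def tendsto_add)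

lemma strongly_tends_to_diff:
  "strongly_tends_to A A' \<Longrightarrow> strongly_tends_to B B' \<Longrightarrow> strongly_tends_to (\<lambda>n. A n - B n) (A' - B')"
  by (simp add: strongly_tends_to_def tendsto_diff)

lemma strongly_tends_to_scaleC:
  "strongly_tends_to A A' \<Longrightarrow> strongly_tends_to (\<lambda>n. c *\<^sub>C A n) (c *\<^sub>C A')"
  by (simp add: strongly_tends_to_def bounded_linear.tendsto[OF bounded_linear_scaleC])

lemma contraction_mult: "contraction A \<Longrightarrow> contraction B \<Longrightarrow> contraction (A * B)"
  unfolding contraction_def by (auto intro: order_trans)

text \<open>
  The polynomials in \<open>E\<close> with nonnegative real coefficients, in Horner form. They are positive
  operators as soon as \<open>E\<close> is, which gives positivity of the products that occur below without the
  theorem that commuting positive operators have a positive product.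
\<close>

inductive_set power_cone ::
    "'a::complex_hilbert_space bounded_op \<Rightarrow> 'a bounded_op set"
  for E where
    zero: "0 \<in> power_cone E"
  | horner: "c \<ge> 0 \<Longrightarrow> X \<in> power_cone E \<Longrightarrow> complex_of_real c *\<^sub>C 1 + E * X \<in> power_cone E"

lemma power_cone_add:
  assumes "X \<in> power_cone E" "Y \<in> power_cone E"
  shows "X + Y \<in> power_cone E"
  using assms
proof (induction arbitrary: Y)
  case zero
  then show ?case by simp
next
  case (horner c X)
  from horner.prems show ?case
  proof cases
    case zero
    then show ?thesis
      using power_cone.horner[OF horner.hyps] by simp
  next
    case (horner d Z)
    have "complex_of_real (c + d) *\<^sub>C 1 + E * (X + Z) \<in> power_cone E"
      using horner horner.IH \<open>0 \<le> c\<close> by (intro power_cone.horner) auto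
    then show ?thesis
      by (simp add: horner algebra_simps scaleC_add_left)
  qed
qed

lemma power_cone_mult_left: "X \<in> power_cone E \<Longrightarrow> E * X \<in> power_cone E"
  using power_cone.horner[of 0 X E] by simp

lemma power_cone_scale:
  assumes "c \<ge> 0" "X \<in> power_cone E"
  shows "complex_of_real c *\<^sub>C X \<in> power_cone E"
  using assms(2)
proof induction
  case zero
  then show ?case by (simp add: power_cone.zero)
next
  case (horner d X)
  then show ?case
    using power_cone.horner[of "c * d" "complex_of_real c *\<^sub>C X" E] \<open>c \<ge> 0\<close>
    by (simp add: scaleC_add_right scaleC_scaleC)
qed

lemma power_cone_mult:
  assumes "X \<in> power_cone E" "Y \<in> power_cone E"
  shows "X * Y \<in> power_cone E"
  using assms(1)
proof induction
  case zero
  then show ?case by (simp add: power_cone.zero)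
next
  case (horner c X)
  have "complex_of_real c *\<^sub>C Y + E * (X * Y) \<in> power_cone E"
    using horner assms(2) by (intro power_cone_add power_cone_mult_left power_cone_scale)
  then show ?case
    by (simp add: algebra_simps)
qed

lemma power_cone_self: "E \<in> power_cone E"
  using power_cone.horner[OF _ power_cone.horner[OF _ power_cone.zero, of 1], of 0 E]
  by (simp add: scaleC_one)

text \<open>
  Half of the factors move to the other side of the inner product; for odd \<open>k\<close> one factor \<open>E\<close> is
  left in the middle.
\<close>

lemma positive_power:
  assumes "adj E = E" "positive_op E"
  shows "positive_op (E ^ k)"
  unfolding positive_op_def
proof
  fix x
  have shift: "inner (op_apply (E ^ (i + l)) y) z = inner (op_apply (E ^ l) y) (op_apply (E ^ i) z)"
    for i l y z
  proof (induction i arbitrary: z)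
    case (Suc i)
    have "op_apply (E ^ i) (op_apply E z) = op_apply (E ^ Suc i) z"
      by (simp only: power_Suc2 op_apply_simps)
    then show ?case
      using Suc.IH[of "op_apply E z"] inner_self_adjoint[OF assms(1)] by simp
  qed simp
  show "0 \<le> inner (op_apply (E ^ k) x) x"
  proof (cases "even k")
    case True
    then obtain l where "k = l + l"
      by (metis dvdE mult_2)
    then show ?thesis
      by (simp add: shift)
  next
    case False
    then obtain l where "k = l + Suc l"
      by (metis Suc_eq_plus1 add.assoc mult_2 oddE)
    then show ?thesis
      using assms(2) by (simp only: shift) (simp add: positive_op_def)
  qed
qed

lemma power_cone_positive:
  assumes "adj E = E" "positive_op E" "X \<in> power_cone E"
  shows "positive_op X"
proof -
  \<comment> \<open>The Horner step multiplies by \<open>E\<close>, so the induction must carry an arbitrary power.\<close>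
  have "positive_op (E ^ k * X)" for k
    using assms(3)
  proof (induction arbitrary: k)
    case zero
    then show ?case by (simp add: positive_op_def)
  next
    case (horner c X)
    have "op_apply (E ^ k * (complex_of_real c *\<^sub>C 1 + E * X)) x =
        c *\<^sub>R op_apply (E ^ k) x + op_apply (E ^ Suc k * X) x" for x
      by (simp only: power_Suc2 op_apply_simps op_apply_linear_simps scaleR_scaleC)
    then show ?case
      using horner positive_power[OF assms(1,2), of k] horner.IH[of "Suc k"]
      unfolding positive_op_def by (simp add: inner_add_left)
  qed
  from this[of 0] show ?thesis
    by simp
qed

text \<open>
  One step \<open>D \<mapsto> (3 D - D\<^sup>3) / 2\<close> of the Newton--Schulz iteration for the sign function.
\<close>

definition newton_sign_step ::
    "'a::complex_hilbert_space bounded_op \<Rightarrow> 'a bounded_op"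
  where "newton_sign_step D = D + (1/2) *\<^sub>C ((1 - D * D) * D)"

text \<open>
  The step turns the defect \<open>E = 1 - D\<^sup>2\<close> into \<open>(3 E\<^sup>2 + E\<^sup>3) / 4\<close>, a polynomial with nonnegative
  coefficients. So positivity of the defect is preserved, and every later defect lies in the
  \<^const>\<open>power_cone\<close> of every earlier one.
\<close>

lemma newton_sign_step_defect:
  defines "E \<equiv> \<lambda>D. 1 - D * D"
  shows "E (newton_sign_step D) = (1/4) *\<^sub>C (E D * E D + E D * E D + E D * E D + E D * E D * E D)"
proof -
  have E: "E X = 1 - X * X" for X
    by (simp add: E_def)
  have D: "newton_sign_step D = (1/2) *\<^sub>C (D + D + E D * D)"
    by (simp add: newton_sign_step_def E_def scaleC_add_right half_scaleC_add_self)
  have one: "1 = (1/4) *\<^sub>C (1 + 1 + 1 + (1 :: 'a bounded_op))"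
    using add_self_eq_scaleC[of "1 :: 'a bounded_op"] add_self_eq_scaleC[of "1 + 1 :: 'a bounded_op"]
    by (simp add: add.assoc scaleC_scaleC scaleC_one)
  have "E (newton_sign_step D) = 1 - (1/4) *\<^sub>C ((D + D + E D * D) * (D + D + E D * D))"
    unfolding D by (subst E) (simp add: scaleC_scaleC)
  also have "\<dots> = (1/4) *\<^sub>C (1 + 1 + 1 + 1 - (D + D + E D * D) * (D + D + E D * D))"
    by (subst one) (simp add: scaleC.scale_right_diff_distrib)
  also have "1 + 1 + 1 + 1 - (D + D + E D * D) * (D + D + E D * D) =
      E D * E D + E D * E D + E D * E D + E D * E D * E D"
    by (simp add: E_def algebra_simps)
  finally show ?thesis .
qed

lemma contraction_iff_defect_positive:
  assumes "adj D = D"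
  shows "contraction D \<longleftrightarrow> positive_op (1 - D * D)"
proof -
  have "inner (op_apply (1 - D * D) x) x = (norm x)\<^sup>2 - (norm (op_apply D x))\<^sup>2" for x
    by (simp add: inner_diff_left inner_self_adjoint[OF assms] power2_norm_eq_inner)
  then show ?thesis
    by (simp add: contraction_def positive_op_def)
qed

text \<open>
  A bounded monotone real sequence \<open>r\<close> controls \<open>X\<close>; this replaces the convergence theorem for
  monotone sequences of operators.
\<close>

lemma Cauchy_of_gap:
  fixes X :: "nat \<Rightarrow> 'a::real_normed_vector" and r :: "nat \<Rightarrow> real"
  assumes gap: "\<And>m n. n \<le> m \<Longrightarrow> (norm (X m - X n))\<^sup>2 \<le> r m - r n" and bound: "\<And>n. r n \<le> B"
  shows "Cauchy X"
proof -
  have "incseq r"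
    using order_trans[OF zero_le_power2 gap] by (intro monoI) simp
  then obtain l where "r \<longlonglongrightarrow> l"
    by (rule incseq_convergent[of r B]) (simp_all add: bound)
  then have "Cauchy r"
    by (rule LIMSEQ_imp_Cauchy)
  show ?thesis
  proof (rule CauchyI')
    fix e :: real assume "e > 0"
    then obtain N where N: "\<And>m n. m \<ge> N \<Longrightarrow> n \<ge> N \<Longrightarrow> norm (r m - r n) < e\<^sup>2"
      using CauchyD[OF \<open>Cauchy r\<close>, of "e\<^sup>2"] by auto
    have "norm (X m - X n) < e" if "m \<ge> N" "n > m" for m n
    proof -
      have "(norm (X n - X m))\<^sup>2 < e\<^sup>2"
        using gap[of m n] N[of n m] that by simp
      then show ?thesis
        using \<open>e > 0\<close> by (simp add: norm_minus_commute power2_less_imp_less)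
    qed
    then show "\<exists>M. \<forall>m\<ge>M. \<forall>n>m. dist (X m) (X n) < e"
      by (auto simp: dist_norm)
  qed
qed

text \<open>
  The limit \<open>S\<close> is the sign of \<open>D\<close>. The Newton iterates satisfy \<open>N m = (1 + C) N n\<close> for \<open>n \<le> m\<close>, with
  \<open>C\<close> a positive polynomial in the defect of \<open>N n\<close>, whence
  \<open>\<langle>N m x, N n x\<rangle> \<ge> \<parallel>N n x\<parallel>\<^sup>2\<close> and therefore \<open>\<parallel>N m x - N n x\<parallel>\<^sup>2 \<le> \<parallel>N m x\<parallel>\<^sup>2 - \<parallel>N n x\<parallel>\<^sup>2\<close>. This makes
  the iterates strongly Cauchy. A fixed point of the step satisfies \<open>S\<^sup>3 = S\<close>, so the self-adjoint \<open>S\<close> is a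
  difference of orthogonal projections. The inequality \<open>D\<^sup>2 \<le> D S\<close>, a form of \<open>D\<^sup>2 \<le> \<bar>D\<bar>\<close>, is the case
  \<open>n = 0\<close> of the growth estimate; the last property holds since each iterate is a left multiple of
  \<open>D\<close> by a polynomial in \<open>D\<close>.
  
  This one lemma takes the place of the spectral theorem: it supplies all the projections that the
  proof needs.
\<close>

lemma sign_exists:
  assumes vN: "von_neumann_algebra M" and D: "D \<in> M" "adj D = D" "contraction D"
  obtains S where "S \<in> M" "adj S = S" "contraction S" "S * S * S = S"
    and "\<And>x. (norm (op_apply D x))\<^sup>2 \<le> inner (op_apply S x) (op_apply D x)"
    and "\<And>X. D * X = 0 \<Longrightarrow> S * X = 0"
proof -
  note closed = von_neumann_algebra_closed[OF vN]
  define N where "N n = (newton_sign_step ^^ n) D" for n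
  define E where "E n = 1 - N n * N n" for n
  have N_0: "N 0 = D" and N_Suc: "N (Suc n) = N n + (1/2) *\<^sub>C (E n * N n)" for n
    by (simp_all add: N_def E_def newton_sign_step_def)
  have E_Suc: "E (Suc n) = (1/4) *\<^sub>C (E n * E n + E n * E n + E n * E n + E n * E n * E n)" for n
    using newton_sign_step_defect[of "N n"] by (simp add: N_def E_def)
  have NM: "N n \<in> M" for n
    by (induction n) (simp_all add: N_0 N_Suc E_def D closed)
  have Nadj: "adj (N n) = N n" for n
    by (induction n) (simp_all add: N_0 N_Suc E_def D algebra_simps)
  then have Eadj: "adj (E n) = E n" for n
    by (simp add: E_def)
  have E_later: "E m \<in> power_cone (E n)" if "n \<le> m" for m n
    using that
  proof (induction rule: dec_induct)
    case base
    then show ?case by (rule power_cone_self)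
  next
    case (step m)
    then show ?case
      unfolding E_Suc
      by (intro power_cone_scale[of "1/4", simplified] power_cone_add power_cone_mult)
  qed
  have Epos: "positive_op (E n)" for n
  proof (induction n)
    case 0
    then show ?case
      using D contraction_iff_defect_positive[of D] by (simp add: E_def N_0)
  next
    case (Suc n)
    then show ?case
      by (rule power_cone_positive[OF Eadj _ E_later]) simp
  qed
  have Ncontr: "contraction (N n)" for n
    using contraction_iff_defect_positive[OF Nadj] Epos by (simp add: E_def)
  have N_later: "\<exists>C \<in> power_cone (E n). N m = N n + C * N n" if "n \<le> m" for m n
    using that
  proof (induction rule: dec_induct)
    case base
    show ?case by (rule bexI[OF _ power_cone.zero]) simp
  next
    case (step m)
    then obtain C where C: "C \<in> power_cone (E n)" "N m = N n + C * N n"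
      by blast
    define C' where "C' = C + ((1/2) *\<^sub>C E m + (1/2) *\<^sub>C (E m * C))"
    have "C' \<in> power_cone (E n)"
      unfolding C'_def using C(1) E_later[OF step(1)]
      by (intro power_cone_scale[of "1/2", simplified] power_cone_add power_cone_mult)
    moreover have "N (Suc m) = N n + C' * N n"
      unfolding N_Suc C'_def by (subst C(2), subst C(2)) (simp add: algebra_simps scaleC_add_right)
    ultimately show ?case
      by blast
  qed
  have growth: "(norm (op_apply (N n) x))\<^sup>2 \<le> inner (op_apply (N m) x) (op_apply (N n) x)"
    if "n \<le> m" for m n x
  proof -
    obtain C where C: "C \<in> power_cone (E n)" "N m = N n + C * N n"
      using N_later[OF \<open>n \<le> m\<close>] by blast
    then have "positive_op C"
      using power_cone_positive Eadj Epos by blast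
    then show ?thesis
      by (simp add: C(2) inner_add_left power2_norm_eq_inner positive_op_def)
  qed
  have "Cauchy (\<lambda>n. op_apply (N n) x)" for x
  proof (rule Cauchy_of_gap)
    show "(norm (op_apply (N m) x - op_apply (N n) x))\<^sup>2
        \<le> (norm (op_apply (N m) x))\<^sup>2 - (norm (op_apply (N n) x))\<^sup>2" if "n \<le> m" for m n
      using growth[OF that, of x]
      by (simp add: power2_norm_eq_inner inner_diff_left inner_diff_right inner_commute)
    show "(norm (op_apply (N n) x))\<^sup>2 \<le> (norm x)\<^sup>2" for n
      using Ncontr by (simp add: contraction_def)
  qed
  then obtain S where S: "strongly_tends_to N S"
    using strong_limit_exists Ncontr by blast
  then have lim: "(\<lambda>n. op_apply (N n) x) \<longlonglongrightarrow> op_apply S x" for x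
    by (simp add: strongly_tends_to_def)
  show thesis
  proof
    show "S \<in> M"
      by (rule von_neumann_algebra_strong_limit[OF vN NM lim])
    show "adj S = S"
    proof (rule adj_eqI)
      fix x y
      have "(\<lambda>n. cinner (op_apply (N n) x) y) \<longlonglongrightarrow> cinner (op_apply S x) y"
        by (rule tendsto_cinner_left[OF lim])
      moreover have "(\<lambda>n. cnj (cinner (op_apply (N n) y) x)) \<longlonglongrightarrow> cnj (cinner (op_apply S y) x)"
        by (intro tendsto_cnj tendsto_cinner_left lim)
      moreover have "cinner (op_apply (N n) x) y = cnj (cinner (op_apply (N n) y) x)" for n
        by (metis Nadj cinner_adj cinner_commute)
      ultimately have "cinner (op_apply S x) y = cnj (cinner (op_apply S y) x)"
        by (simp add: LIMSEQ_unique)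
      then show "cinner (op_apply S x) y = cinner x (op_apply S y)"
        by (simp flip: cinner_commute)
    qed
    show "contraction S"
      unfolding contraction_def
      using Lim_bounded[OF tendsto_norm[OF lim]] Ncontr by (simp add: contraction_def)
    have "strongly_tends_to (\<lambda>n. N (Suc n)) (S + (1/2) *\<^sub>C ((1 - S * S) * S))"
    proof -
      have "strongly_tends_to (\<lambda>n. N n * N n * N n) (S * S * S)"
        by (intro strongly_tends_to_mult S Ncontr contraction_mult)
      then have "strongly_tends_to (\<lambda>n. N n + (1/2) *\<^sub>C (N n - N n * N n * N n))
          (S + (1/2) *\<^sub>C (S - S * S * S))"
        by (intro strongly_tends_to_add strongly_tends_to_scaleC strongly_tends_to_diff S)
      then show ?thesis
        by (simp add: N_Suc E_def algebra_simps)
    qed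
    moreover have "strongly_tends_to (\<lambda>n. N (Suc n)) S"
      using LIMSEQ_Suc[OF lim] by (simp add: strongly_tends_to_def)
    ultimately have "S = S + (1/2) *\<^sub>C ((1 - S * S) * S)"
      using strongly_tends_to_unique by blast
    then show "S * S * S = S"
      by (simp add: algebra_simps)
    show "(norm (op_apply D x))\<^sup>2 \<le> inner (op_apply S x) (op_apply D x)" for x
    proof (rule LIMSEQ_le_const)
      show "(\<lambda>n. inner (op_apply (N n) x) (op_apply D x)) \<longlonglongrightarrow> inner (op_apply S x) (op_apply D x)"
        by (intro tendsto_inner lim tendsto_const)
      show "\<exists>k. \<forall>n\<ge>k. (norm (op_apply D x))\<^sup>2 \<le> inner (op_apply (N n) x) (op_apply D x)"
        using growth[of 0 _ x] by (simp add: N_0)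
    qed
    show "S * X = 0" if "D * X = 0" for X
    proof -
      have "N n * X = 0" for n
        by (induction n) (simp_all add: N_0 N_Suc that algebra_simps mult.assoc)
      then have "op_apply (N n) (op_apply X x) = 0" for n x
        by (metis op_apply_simps(1,6))
      then have "op_apply S (op_apply X x) = 0" for x
        using lim[of "op_apply X x"] by (simp add: LIMSEQ_const_iff)
      then show ?thesis
        by (intro op_eqI) simp
    qed
  qed
qed

section \<open>The additivity defect of a star-Lie map\<close>

text \<open>
  The case of two variables, to which the general one reduces.
\<close>

locale star_lie_bijection =
  fixes M :: "'a::complex_hilbert_space bounded_op set" and \<phi> :: "'a bounded_op \<Rightarrow> 'a bounded_op"
  assumes vN: "von_neumann_algebra M"
    and bij: "bij_betw \<phi> M M"
    and unital: "\<phi> 1 = 1"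
    and scale: "A \<in> M \<Longrightarrow> \<phi> (c *\<^sub>C A) = c *\<^sub>C \<phi> A"
    and lie: "x \<in> M \<Longrightarrow> y \<in> M \<Longrightarrow> \<phi> (star_commutator x y) = star_commutator (\<phi> x) (\<phi> y)"
begin

lemmas closed [simp] = von_neumann_algebra_closed[OF vN]

lemma phi_in [simp]: "x \<in> M \<Longrightarrow> \<phi> x \<in> M"
  using bij bij_betwE by blast

lemma phi_inj: "x \<in> M \<Longrightarrow> y \<in> M \<Longrightarrow> \<phi> x = \<phi> y \<Longrightarrow> x = y"
  using bij by (metis bij_betw_def inj_onD)

lemma phi_surj:
  assumes "y \<in> M"
  obtains x where "x \<in> M" "\<phi> x = y"
  using bij assms by (metis bij_betw_imp_surj_on imageE)

lemma phi_zero [simp]: "\<phi> 0 = 0"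
  using scale[of 0 0] by simp

lemma phi_minus: "x \<in> M \<Longrightarrow> \<phi> (- x) = - \<phi> x"
  using scale[of x "- 1"] by (simp add: scaleC_one)

lemma phi_double: "x \<in> M \<Longrightarrow> \<phi> (x + x) = \<phi> x + \<phi> x"
  by (simp add: add_self_eq_scaleC scale)

text \<open>
  Replacing \<open>x\<close> by \<open>\<i> x\<close> in the star-commutator turns its minus sign into a plus sign.
\<close>

lemma phi_star_jordan:
  assumes "x \<in> M" "y \<in> M"
  shows "\<phi> (x * y + y * adj x) = \<phi> x * \<phi> y + \<phi> y * adj (\<phi> x)"
proof -
  have i: "star_commutator (\<i> *\<^sub>C u) v = \<i> *\<^sub>C (u * v + v * adj u)" for u v :: "'a bounded_op"
    by (simp add: star_commutator_def scaleC_add_right)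
  have "\<i> *\<^sub>C \<phi> (x * y + y * adj x) = \<i> *\<^sub>C (\<phi> x * \<phi> y + \<phi> y * adj (\<phi> x))"
    using lie[of "\<i> *\<^sub>C x" y] assms by (simp add: i scale)
  then show ?thesis
    by simp
qed

lemma phi_real_part: "x \<in> M \<Longrightarrow> \<phi> (x + adj x) = \<phi> x + adj (\<phi> x)"
  using phi_star_jordan[of x 1] by (simp add: unital)

lemma phi_imaginary_part: "x \<in> M \<Longrightarrow> \<phi> (x - adj x) = \<phi> x - adj (\<phi> x)"
  using lie[of x 1] by (simp add: unital star_commutator_def)

lemma phi_adj:
  assumes "x \<in> M"
  shows "\<phi> (adj x) = adj (\<phi> x)"
proof -
  have "\<phi> (adj x) + adj (\<phi> (adj x)) = \<phi> x + adj (\<phi> x)"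
    using phi_real_part[of "adj x"] phi_real_part[of x] assms by (simp add: add.commute)
  moreover have "\<phi> (adj x) - adj (\<phi> (adj x)) = - (\<phi> x - adj (\<phi> x))"
    using phi_imaginary_part[of "adj x"] phi_imaginary_part[of x] phi_minus[of "x - adj x"] assms
    by simp
  moreover have "\<phi> (adj x) + \<phi> (adj x) =
      (\<phi> (adj x) + adj (\<phi> (adj x))) + (\<phi> (adj x) - adj (\<phi> (adj x)))"
    by simp
  ultimately have "2 *\<^sub>C \<phi> (adj x) = 2 *\<^sub>C adj (\<phi> x)"
    by (simp only: add_self_eq_scaleC[symmetric]) simp
  then show ?thesis
    by simp
qed

text \<open>
  The first instance of additivity: the parts \<open>a\<close> and \<open>c\<close> are, up to a factor, the images of
  \<open>a + c\<close> under \<open>x \<mapsto> x + adj x\<close> and \<open>x \<mapsto> x - adj x\<close>, with which \<open>\<phi>\<close> commutes.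
\<close>

lemma phi_add_cartesian:
  assumes "a \<in> M" "adj a = a" "c \<in> M" "adj c = - c"
  shows "\<phi> (a + c) = \<phi> a + \<phi> c"
proof -
  have "\<phi> (a + a) + \<phi> (c + c) = \<phi> (a + c) + \<phi> (a + c)"
    using phi_real_part[of "a + c"] phi_imaginary_part[of "a + c"] assms
    by (simp add: algebra_simps)
  then have "2 *\<^sub>C (\<phi> a + \<phi> c) = 2 *\<^sub>C \<phi> (a + c)"
    using assms by (simp add: phi_double scaleC_add_right flip: add_self_eq_scaleC)
  then show ?thesis
    by simp
qed

lemma phi_jordan:
  assumes "a \<in> M" "adj a = a" "y \<in> M"
  shows "\<phi> (a * y + y * a) = \<phi> a * \<phi> y + \<phi> y * \<phi> a"
  using phi_star_jordan[of a y] assms by (simp flip: phi_adj)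

lemma phi_commutator:
  assumes "a \<in> M" "adj a = a" "y \<in> M"
  shows "\<phi> (a * y - y * a) = \<phi> a * \<phi> y - \<phi> y * \<phi> a"
  using lie[of a y] assms by (simp add: star_commutator_def flip: phi_adj)

end

text \<open>
  A symmetry \<open>j = 2 p - 1\<close> encodes the projection \<open>p\<close>. Elements that commute with \<open>j\<close> are the
  diagonal part of the Peirce decomposition for \<open>p\<close>, those that anticommute with \<open>j\<close> the
  off-diagonal part. Stated through \<open>j\<close> the decomposition needs no corner computations, and \<open>\<phi>\<close>
  visibly respects it: \<open>\<phi> j\<close> is again a symmetry, and \<open>\<phi>\<close> carries commutation and anticommutation
  with \<open>j\<close> to the same relation with \<open>\<phi> j\<close>.
\<close>

locale star_lie_symmetry = star_lie_bijection +
  fixes j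
  assumes j_in [simp]: "j \<in> M" and j_adj [simp]: "adj j = j" and j_square [simp]: "j * j = 1"
begin

lemma j_cancel [simp]: "j * (j * x) = x" "x * j * j = x"
  by (simp_all add: mult.assoc flip: mult.assoc[of j])

lemma phi_j_square [simp]: "\<phi> j * \<phi> j = 1"
proof -
  have "\<phi> j * \<phi> j + \<phi> j * \<phi> j = \<phi> (1 + 1)"
    using phi_jordan[of j j] by simp
  then have "2 *\<^sub>C (\<phi> j * \<phi> j) = 2 *\<^sub>C 1"
    using phi_double[of 1] by (simp add: unital flip: add_self_eq_scaleC)
  then show ?thesis
    by simp
qed

lemma phi_j_cancel [simp]: "\<phi> j * (\<phi> j * x) = x"
  by (simp flip: mult.assoc)

lemma phi_diagonal: "x \<in> M \<Longrightarrow> x * j = j * x \<Longrightarrow> \<phi> x * \<phi> j = \<phi> j * \<phi> x"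
  using phi_commutator[of j x] by simp

lemma phi_off_diagonal: "x \<in> M \<Longrightarrow> x * j = - (j * x) \<Longrightarrow> \<phi> x * \<phi> j = - (\<phi> j * \<phi> x)"
  using phi_jordan[of j x] by (simp add: eq_neg_iff_add_eq_0 add.commute)

text \<open>
  For \<open>x = (D + V) j\<close> the summands \<open>D j\<close> and \<open>V j\<close> are the self-adjoint and the skew part, so \<open>\<phi>\<close>
  is additive on them; and \<open>x j + j x\<^sup>* = 2 (D + V)\<close> depends additively on \<open>x\<close>.
\<close>

lemma phi_add_diagonal_off_diagonal:
  assumes D: "D \<in> M" "adj D = D" "D * j = j * D"
    and V: "V \<in> M" "adj V = V" "V * j = - (j * V)"
  shows "\<phi> (D + V) = \<phi> D + \<phi> V"
proof -
  have star: "X * j * j + j * adj (X * j) = X + X" if "adj X = X" for X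
    using that by simp
  have "\<phi> (D * j + V * j) = \<phi> (D * j) + \<phi> (V * j)"
    using D V by (intro phi_add_cartesian) (simp_all flip: D(3))
  then have "\<phi> ((D + V) * j) * \<phi> j + \<phi> j * adj (\<phi> ((D + V) * j)) =
      (\<phi> (D * j) * \<phi> j + \<phi> j * adj (\<phi> (D * j))) + (\<phi> (V * j) * \<phi> j + \<phi> j * adj (\<phi> (V * j)))"
    by (simp add: algebra_simps)
  then have "\<phi> ((D + V) + (D + V)) = \<phi> (D + D) + \<phi> (V + V)"
    using D(1) V(1) star[OF D(2)] star[OF V(2)] star[of "D + V"] D(2) V(2)
    by (simp only: phi_star_jordan[symmetric] closed j_in adj_add)
  then have "2 *\<^sub>C \<phi> (D + V) = 2 *\<^sub>C (\<phi> D + \<phi> V)"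
    using D V by (simp add: phi_double[of "D + V"] phi_double scaleC_add_right flip: add_self_eq_scaleC)
  then show ?thesis
    by simp
qed

text \<open>
  The Jordan product of \<open>1 + V\<close> and \<open>1 + W\<close> has the off-diagonal part \<open>2 (V + W)\<close>. Apply \<open>\<phi>\<close> to
  this product and compare the parts that anticommute with \<open>\<phi> j\<close>.
\<close>

lemma phi_add_off_diagonal:
  assumes V: "V \<in> M" "adj V = V" "V * j = - (j * V)"
    and W: "W \<in> M" "adj W = W" "W * j = - (j * W)"
  shows "\<phi> (V + W) = \<phi> V + \<phi> W"
proof -
  let ?k = "\<phi> j"
  define D where "D = (1 + 1) + (V * W + W * V)"
  have j_right: "X * Y * j = j * X * Y" if "X * j = - (j * X)" "Y * j = - (j * Y)" for X Y
    by (metis (no_types, opaque_lifting) that mult.assoc minus_mult_minus mult_minus_left mult_minus_right)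
  have D: "D \<in> M" "adj D = D" "D * j = j * D"
    using V W j_right[of V W] j_right[of W V]
    by (simp_all add: D_def add.commute algebra_simps)
  have VW: "V * W + W * V \<in> M" "(V * W + W * V) * j = j * (V * W + W * V)"
    using V W j_right[of V W] j_right[of W V] by (simp_all add: algebra_simps)
  have one: "\<phi> (1 + X) = 1 + \<phi> X" if "X \<in> M" "adj X = X" "X * j = - (j * X)" for X
    using phi_add_diagonal_off_diagonal[of 1 X] that by (simp add: unital)
  have sum: "(V + W) * j = - (j * (V + W))"
    using V W by (simp add: algebra_simps)
  have double: "((V + W) + (V + W)) * j = - (j * ((V + W) + (V + W)))"
    using V W by (simp add: algebra_simps)
  have "(1 + V) * (1 + W) + (1 + W) * (1 + V) = D + ((V + W) + (V + W))"
    by (simp add: D_def algebra_simps)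
  then have expand: "\<phi> D + (\<phi> (V + W) + \<phi> (V + W)) =
      (1 + \<phi> V) * (1 + \<phi> W) + (1 + \<phi> W) * (1 + \<phi> V)"
    using phi_jordan[of "1 + V" "1 + W"] V W D sum double
    by (simp add: one unital phi_add_diagonal_off_diagonal phi_double)
  define X where "X = \<phi> D - (1 + 1) - \<phi> (V * W + W * V)"
  define Y where "Y = \<phi> (V + W) - (\<phi> V + \<phi> W)"
  \<comment> \<open>\<open>X\<close> collects the diagonal terms and \<open>Y + Y\<close> the off-diagonal ones, so both vanish; only \<open>Y\<close> matters.\<close>
  have "X + (Y + Y) = (\<phi> D + (\<phi> (V + W) + \<phi> (V + W))) -
      ((1 + \<phi> V) * (1 + \<phi> W) + (1 + \<phi> W) * (1 + \<phi> V))"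
    unfolding X_def Y_def phi_jordan[OF V(1,2) W(1)] by (simp add: algebra_simps)
  then have XY: "X + (Y + Y) = 0"
    by (simp only: expand) simp
  have X: "X * ?k = ?k * X"
    using phi_diagonal[OF D(1,3)] phi_diagonal[OF VW] by (simp add: X_def algebra_simps)
  have Y: "Y * ?k = - (?k * Y)"
    using phi_off_diagonal[OF _ sum] phi_off_diagonal[of V] phi_off_diagonal[of W] V W
    by (simp add: Y_def algebra_simps)
  have "(Y + Y) * ?k = ?k * (Y + Y)"
    using X XY by (metis add_eq_0_iff minus_mult_left mult_minus_right)
  then have "2 *\<^sub>C (?k * Y) = - (2 *\<^sub>C (?k * Y))"
    by (simp add: distrib_left distrib_right Y flip: add_self_eq_scaleC)
  then have "4 *\<^sub>C (?k * Y) = 0"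
    by (simp add: eq_neg_iff_add_eq_0 flip: scaleC_add_left)
  then have "?k * Y = 0"
    by simp
  then have "Y = 0"
    by (metis phi_j_cancel mult_zero_right)
  then show ?thesis
    by (simp add: Y_def)
qed

lemma phi_add_off_diagonal_skew:
  assumes V: "V \<in> M" "adj V = - V" "V * j = - (j * V)"
    and W: "W \<in> M" "adj W = - W" "W * j = - (j * W)"
  shows "\<phi> (V + W) = \<phi> V + \<phi> W"
proof -
  have "\<i> *\<^sub>C \<phi> (V + W) = \<i> *\<^sub>C (\<phi> V + \<phi> W)"
    using phi_add_off_diagonal[of "\<i> *\<^sub>C V" "\<i> *\<^sub>C W"] assms
    by (simp add: scale flip: scaleC_add_right)
  then show ?thesis
    by simp
qed

text \<open>
  Products of a diagonal and an off-diagonal element are off-diagonal, where \<open>\<phi>\<close> is additive. Hence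
  the defect of additivity on the diagonal is annihilated by both the Jordan product and the
  commutator with \<open>W\<close>.
\<close>

lemma diagonal_defect:
  assumes D: "D \<in> M" "adj D = D" "D * j = j * D"
    and D': "D' \<in> M" "adj D' = D'" "D' * j = j * D'"
    and W: "W \<in> M" "adj W = W" "W * \<phi> j = - (\<phi> j * W)"
  shows "(\<phi> (D + D') - \<phi> D - \<phi> D') * W = 0" (is "?d * W = 0")
proof -
  obtain V where V: "V \<in> M" "\<phi> V = W"
    using phi_surj[OF W(1)] .
  have Vadj: "adj V = V"
    using phi_inj[of "adj V" V] V W by (simp add: phi_adj)
  have "\<phi> (j * V + V * j) = \<phi> 0"
    using phi_jordan[of j V] V W by simp
  then have "j * V + V * j = 0"
    using phi_inj[of "j * V + V * j" 0] V by simp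
  then have Voff: "V * j = - (j * V)"
    by (simp add: eq_neg_iff_add_eq_0 add.commute)
  have off: "(X * V) * j = - (j * (X * V))" "(V * X) * j = - (j * (V * X))"
    if "X * j = j * X" for X
    by (metis (no_types, opaque_lifting) that Voff mult.assoc mult_minus_left mult_minus_right)+
  have "\<phi> ((D * V + V * D) + (D' * V + V * D')) = \<phi> (D * V + V * D) + \<phi> (D' * V + V * D')"
    using D D' V Vadj by (intro phi_add_off_diagonal) (simp_all add: add.commute distrib_left distrib_right off)
  moreover have "(D + D') * V + V * (D + D') = (D * V + V * D) + (D' * V + V * D')"
    by (simp add: algebra_simps)
  moreover have "?d * W + W * ?d =
      \<phi> ((D + D') * V + V * (D + D')) - \<phi> (D * V + V * D) - \<phi> (D' * V + V * D')"
    using D D' V by (simp only: phi_jordan closed adj_add) (simp add: algebra_simps)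
  ultimately have sum: "?d * W + W * ?d = 0"
    by simp
  have "\<phi> ((D * V - V * D) + (D' * V - V * D')) = \<phi> (D * V - V * D) + \<phi> (D' * V - V * D')"
    using D D' V Vadj
    by (intro phi_add_off_diagonal_skew)
      (simp_all add: right_diff_distrib left_diff_distrib off)
  moreover have "(D + D') * V - V * (D + D') = (D * V - V * D) + (D' * V - V * D')"
    by (simp add: algebra_simps)
  moreover have "?d * W - W * ?d =
      \<phi> ((D + D') * V - V * (D + D')) - \<phi> (D * V - V * D) - \<phi> (D' * V - V * D')"
    using D D' V by (simp only: phi_commutator closed adj_add) (simp add: algebra_simps)
  ultimately have diff: "?d * W - W * ?d = 0"
    by simp
  have "2 *\<^sub>C (?d * W) = 0"
    using sum diff by (simp flip: add_self_eq_scaleC)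
  then show ?thesis
    by simp
qed

text \<open>
  Additivity can fail only on the diagonal, and there the defect annihilates the off-diagonal
  elements. Every commutator with \<open>\<phi> j\<close> is off-diagonal with respect to \<open>\<phi> j\<close>.
\<close>

lemma symmetry_defect:
  assumes u: "u \<in> M" "adj u = u" and v: "v \<in> M" "adj v = v" and A: "A \<in> M"
  shows "(\<phi> (u + v) - \<phi> u - \<phi> v) * (\<phi> j * A - A * \<phi> j) = 0" (is "?d * _ = 0")
proof -
  let ?k = "\<phi> j"
  \<comment> \<open>Twice the diagonal and twice the off-diagonal part; halves are avoided by doubling.\<close>
  define D where "D X = X + j * X * j" for X
  define V where "V X = X - j * X * j" for X
  have D: "D X \<in> M" "adj (D X) = D X" "D X * j = j * D X"
    and V: "V X \<in> M" "adj (V X) = V X" "V X * j = - (j * V X)"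
    if "X \<in> M" "adj X = X" for X
    using that by (simp_all add: D_def V_def algebra_simps)
  have split: "\<phi> X + \<phi> X = \<phi> (D X) + \<phi> (V X)" if "X \<in> M" "adj X = X" for X
  proof -
    have "X + X = D X + V X"
      by (simp add: D_def V_def)
    then show ?thesis
      using phi_add_diagonal_off_diagonal[OF D[OF that] V[OF that]] phi_double[OF that(1)] by simp
  qed
  have "D (u + v) = D u + D v" "V (u + v) = V u + V v"
    by (simp_all add: D_def V_def algebra_simps)
  then have dd: "?d + ?d = \<phi> (D u + D v) - \<phi> (D u) - \<phi> (D v)"
    using split[of "u + v"] split[OF u] split[OF v] u v
      phi_add_off_diagonal[OF V[OF u] V[OF v]]
    by (simp add: algebra_simps)
  have sa: "?d * W = 0" if "W \<in> M" "adj W = W" "W * ?k = - (?k * W)" for W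
  proof -
    have "2 *\<^sub>C (?d * W) = (?d + ?d) * W"
      by (simp only: distrib_right add_self_eq_scaleC[symmetric])
    also have "\<dots> = 0"
      unfolding dd by (rule diagonal_defect[OF D[OF u] D[OF v] that])
    finally show ?thesis
      by simp
  qed
  have k: "?k \<in> M" "adj ?k = ?k"
    by (simp_all flip: phi_adj)
  have skew: "?d * (\<i> *\<^sub>C (?k * B - B * ?k)) = 0" if "B \<in> M" "adj B = B" for B
    using that k by (intro sa) (simp_all add: algebra_simps scaleC.scale_right_diff_distrib)
  have "?d * (?k * (A + adj A) - (A + adj A) * ?k) = 0"
    using skew[of "A + adj A"] A by (simp add: add.commute)
  moreover have "?d * (?k * (A - adj A) - (A - adj A) * ?k) = 0"
  proof -
    have "?d * (\<i> *\<^sub>C (?k * (\<i> *\<^sub>C X) - (\<i> *\<^sub>C X) * ?k)) = - (?d * (?k * X - X * ?k))" for X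
      by (simp add: scaleC_one flip: scaleC.scale_right_diff_distrib) (simp add: right_diff_distrib)
    moreover have "adj (\<i> *\<^sub>C (A - adj A)) = \<i> *\<^sub>C (A - adj A)"
      by (simp flip: scaleC.scale_minus_right)
    ultimately show ?thesis
      using skew[of "\<i> *\<^sub>C (A - adj A)"] A by simp
  qed
  moreover have "?d * (?k * A - A * ?k) + ?d * (?k * A - A * ?k) =
      ?d * (?k * (A + adj A) - (A + adj A) * ?k) + ?d * (?k * (A - adj A) - (A - adj A) * ?k)"
    by (simp add: algebra_simps)
  ultimately have "2 *\<^sub>C (?d * (?k * A - A * ?k)) = 0"
    by (simp only: add_self_eq_scaleC) simp
  then show ?thesis
    by simp
qed

end

context star_lie_bijection
begin

lemma symmetry_annihilates:
  assumes u: "u \<in> M" "adj u = u" and v: "v \<in> M" "adj v = v"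
    and k: "k \<in> M" "adj k = k" "k * k = 1" and A: "A \<in> M"
  shows "(\<phi> (u + v) - \<phi> u - \<phi> v) * (k * A - A * k) = 0"
proof -
  obtain j where j: "j \<in> M" "\<phi> j = k"
    using phi_surj[OF k(1)] .
  have jadj: "adj j = j"
    using phi_inj[of "adj j" j] j k by (simp add: phi_adj)
  have "\<phi> (j * j + j * j) = \<phi> (1 + 1)"
    using phi_jordan[of j j] phi_double[of 1] j jadj k by (simp add: unital)
  then have "j * j + j * j = 1 + 1"
    using phi_inj[of "j * j + j * j" "1 + 1"] j by simp
  then have "j * j = 1"
    by (simp add: add_self_eq_scaleC)
  then interpret star_lie_symmetry M \<phi> j
    by unfold_locales (use j jadj in auto)
  show ?thesis
    using symmetry_defect[OF u v A] j by simp
qed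

end

section \<open>Annihilators of commutators\<close>

text \<open>
  For self-adjoint \<open>S\<close> with \<open>S\<^sup>3 = S\<close>, the operators \<open>(S\<^sup>2 \<plusminus> S) / 2\<close> are projections, so \<open>S\<^sup>2 \<plusminus> S - 1\<close> are symmetries, and
  their difference is \<open>2 S\<close>.
\<close>

lemma partial_symmetry_annihilates:
  assumes vN: "von_neumann_algebra M"
    and sym: "\<And>k A. k \<in> M \<Longrightarrow> adj k = k \<Longrightarrow> k * k = 1 \<Longrightarrow> A \<in> M \<Longrightarrow> d * (k * A - A * k) = 0"
    and S: "S \<in> M" "adj S = S" "S * S * S = S" and A: "A \<in> M"
  shows "d * (S * A - A * S) = 0"
proof -
  note closed = von_neumann_algebra_closed[OF vN]
  have S3: "S * (S * S) = S" "S * (S * (S * X)) = S * X" for X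
    using S(3) by (simp_all flip: mult.assoc)
  define k where "k = S * S + S - 1"
  define l where "l = S * S - S - 1"
  have "d * (k * A - A * k) = 0"
    by (rule sym) (use S A in \<open>simp_all add: k_def closed S3 algebra_simps\<close>)
  moreover have "d * (l * A - A * l) = 0"
    by (rule sym) (use S A in \<open>simp_all add: l_def closed S3 algebra_simps\<close>)
  moreover have "d * (S * A - A * S) + d * (S * A - A * S) = d * (k * A - A * k) - d * (l * A - A * l)"
    by (simp add: k_def l_def algebra_simps)
  ultimately have "2 *\<^sub>C (d * (S * A - A * S)) = 0"
    by (simp only: add_self_eq_scaleC) simp
  then show ?thesis
    by simp
qed

lemma contraction_multiple:
  obtains c where "c > 0" "contraction (complex_of_real c *\<^sub>C A)"
proof -
  obtain K where K: "K > 0" "\<And>x. norm (op_apply A x) \<le> K * norm x"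
    using op_apply_bound[of A] by auto
  have "op_apply (complex_of_real (1 / K) *\<^sub>C A) x = (1 / K) *\<^sub>R op_apply A x" for x
    by (simp only: scaleR_scaleC op_apply_simps)
  then have "contraction (complex_of_real (1 / K) *\<^sub>C A)"
    unfolding contraction_def using K by (simp add: field_simps)
  then show thesis
    using that[of "1 / K"] K by simp
qed

text \<open>
  Passage from symmetries to arbitrary elements, which the spectral theorem would give by norm
  approximation. For a self-adjoint contraction \<open>X\<close> with sign \<open>S\<close>, the operator \<open>2 X - S\<close> is again
  a self-adjoint contraction: \<open>(2 X - S)\<^sup>2 = 4 (X\<^sup>2 - X S) + S\<^sup>2 \<le> S\<^sup>2\<close>. The functional
  \<open>L X = d (X A - A X)\<close> vanishes at \<open>S\<close>, so \<open>L X\<close> is half of a value of \<open>L\<close> at another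
  contraction. As \<open>L\<close> is bounded on contractions, iterating gives \<open>L X = 0\<close>.
\<close>

lemma commutator_annihilates_of_symmetries:
  fixes M :: "'a::complex_hilbert_space bounded_op set"
  assumes vN: "von_neumann_algebra M"
    and sym: "\<And>k A. k \<in> M \<Longrightarrow> adj k = k \<Longrightarrow> k * k = 1 \<Longrightarrow> A \<in> M \<Longrightarrow> d * (k * A - A * k) = 0"
    and B: "B \<in> M" and A: "A \<in> M"
  shows "d * (B * A - A * B) = 0"
proof -
  note closed = von_neumann_algebra_closed[OF vN]
  define L where "L X = d * (X * A - A * X)" for X
  have L_add: "L (X + Y) = L X + L Y" and L_scale: "L (c *\<^sub>C X) = c *\<^sub>C L X" for X Y c
    by (simp_all add: L_def algebra_simps scaleC.scale_right_diff_distrib)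
  obtain Kd where Kd: "Kd > 0" "\<And>x. norm (op_apply d x) \<le> Kd * norm x"
    using op_apply_bound[of d] by auto
  obtain Ka where Ka: "Ka > 0" "\<And>x. norm (op_apply A x) \<le> Ka * norm x"
    using op_apply_bound[of A] by auto
  have bound: "norm (op_apply (L X) x) \<le> 2 * Kd * Ka * norm x" if "contraction X" for X x
  proof -
    have "norm (op_apply X (op_apply A x)) \<le> Ka * norm x"
      using that Ka(2)[of x] unfolding contraction_def by (meson order_trans)
    moreover have "norm (op_apply A (op_apply X x)) \<le> Ka * norm x"
      using that Ka unfolding contraction_def
      by (meson less_imp_le mult_left_mono order_trans)
    ultimately have "norm (op_apply (X * A - A * X) x) \<le> 2 * (Ka * norm x)"
      using norm_triangle_ineq4[of "op_apply X (op_apply A x)" "op_apply A (op_apply X x)"] by simp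
    then have "norm (op_apply d (op_apply (X * A - A * X) x)) \<le> Kd * (2 * (Ka * norm x))"
      using Kd by (meson less_imp_le mult_left_mono order_trans)
    then show ?thesis
      by (simp add: L_def mult_ac)
  qed
  have halving: "\<exists>Y. Y \<in> M \<and> adj Y = Y \<and> contraction Y \<and> L X = (1/2) *\<^sub>C L Y"
    if X: "X \<in> M" "adj X = X" "contraction X" for X
  proof -
    obtain S where S: "S \<in> M" "adj S = S" "contraction S" "S * S * S = S"
      "\<And>x. (norm (op_apply X x))\<^sup>2 \<le> inner (op_apply S x) (op_apply X x)"
      using sign_exists[OF vN X] by metis
    have LS: "L S = 0"
      unfolding L_def by (rule partial_symmetry_annihilates[OF vN sym S(1,2,4) A])
    have "contraction (X + X - S)"
      unfolding contraction_def
    proof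
      fix x
      have "(norm (op_apply (X + X - S) x))\<^sup>2 \<le> (norm (op_apply S x))\<^sup>2"
        using S(5)[of x]
        by (simp add: power2_norm_eq_inner inner_diff_left inner_diff_right inner_add_left
            inner_add_right inner_commute)
      also have "\<dots> \<le> (norm x)\<^sup>2"
        using S(3) by (intro power_mono) (simp_all add: contraction_def)
      finally show "norm (op_apply (X + X - S) x) \<le> norm x"
        by (rule power2_le_imp_le) simp
    qed
    moreover have "L X = (1/2) *\<^sub>C L (X + X - S)"
    proof -
      have "L (X + X - S) + L S = L X + L X"
        by (simp flip: L_add)
      then have "L (X + X - S) = 2 *\<^sub>C L X"
        by (simp add: LS add_self_eq_scaleC)
      then show ?thesis
        by (simp add: scaleC_scaleC scaleC_one)
    qed
    ultimately show ?thesis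
      using X S closed by (intro exI[of _ "X + X - S"]) simp
  qed
  have small: "norm (op_apply (L X) x) \<le> (1/2) ^ n * (2 * Kd * Ka * norm x)"
    if "X \<in> M" "adj X = X" "contraction X" for X n x
    using that
  proof (induction n arbitrary: X)
    case 0
    then show ?case
      using bound by simp
  next
    case (Suc n)
    then obtain Y where Y: "Y \<in> M" "adj Y = Y" "contraction Y" "L X = (1/2) *\<^sub>C L Y"
      using halving by blast
    have "op_apply (L X) x = (1/2) *\<^sub>R op_apply (L Y) x"
      by (simp add: Y(4) scaleR_scaleC)
    then have "norm (op_apply (L X) x) = (1/2) * norm (op_apply (L Y) x)"
      by simp
    then show ?case
      using Suc.IH[OF Y(1-3)] by simp
  qed
  have contr: "L X = 0" if X: "X \<in> M" "adj X = X" "contraction X" for X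
  proof (rule op_eqI)
    fix x :: 'a
    have "(\<lambda>n. (1/2) ^ n * (2 * Kd * Ka * norm x)) \<longlonglongrightarrow> 0"
      by (intro tendsto_mult_left_zero LIMSEQ_power_zero) simp
    then have "norm (op_apply (L X) x) \<le> 0"
      using small[OF X] by (intro LIMSEQ_le_const) auto
    then show "op_apply (L X) x = op_apply 0 x"
      by simp
  qed
  have sa: "L X = 0" if X: "X \<in> M" "adj X = X" for X
  proof -
    obtain c where c: "c > 0" "contraction (complex_of_real c *\<^sub>C X)"
      by (rule contraction_multiple)
    then have "complex_of_real c *\<^sub>C L X = 0"
      using contr[of "complex_of_real c *\<^sub>C X"] X closed by (simp add: L_scale)
    then show ?thesis
      using c by simp
  qed
  have "L (B + adj B) = 0"
    using B closed by (intro sa) (simp_all add: add.commute)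
  moreover have "L (\<i> *\<^sub>C (B - adj B)) = 0"
    using B closed by (intro sa) (simp_all flip: scaleC.scale_minus_right)
  then have "L (B - adj B) = 0"
    by (simp add: L_scale)
  ultimately have "L ((B + adj B) + (B - adj B)) = 0"
    by (simp only: L_add) simp
  then have "2 *\<^sub>C L B = 0"
    by (simp add: L_scale add_self_eq_scaleC)
  then show ?thesis
    by (simp add: L_def)
qed

text \<open>
  The sign \<open>S\<close> of a multiple of \<open>d\<close> annihilates all commutators too, and so does the projection
  \<open>P = S\<^sup>2\<close>. From \<open>P A B = P B A\<close> and its adjoint, \<open>P A = P A P = A P\<close>. Thus \<open>P\<close> is central and \<open>M P\<close>
  is abelian, which forces \<open>P = 0\<close>, then \<open>S = 0\<close> and finally \<open>d = 0\<close>.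
\<close>

lemma commutator_annihilator_trivial:
  fixes M :: "'a::complex_hilbert_space bounded_op set"
  assumes vN: "von_neumann_algebra M" and no_abelian: "\<not> has_central_summand_type_I 1 M"
    and d: "d \<in> M" "adj d = d"
    and ann: "\<And>A B. A \<in> M \<Longrightarrow> B \<in> M \<Longrightarrow> d * (A * B - B * A) = 0"
  shows "d = 0"
proof -
  note closed [simp] = von_neumann_algebra_closed[OF vN]
  obtain c where c: "c > 0" "contraction (complex_of_real c *\<^sub>C d)"
    by (rule contraction_multiple)
  obtain S where S: "S \<in> M" "adj S = S" "S * S * S = S"
    and SD: "\<And>x. (norm (op_apply (complex_of_real c *\<^sub>C d) x))\<^sup>2
      \<le> inner (op_apply S x) (op_apply (complex_of_real c *\<^sub>C d) x)"
    and S_ann: "\<And>X. complex_of_real c *\<^sub>C d * X = 0 \<Longrightarrow> S * X = 0"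
    using sign_exists[OF vN _ _ c(2)] d by (metis adj_scaleC closed(6) complex_cnj_complex_of_real)
  define P where "P = S * S"
  have P: "P \<in> M" "adj P = P" "P * P = P"
    using S by (simp_all add: P_def flip: mult.assoc)
  have P_comm: "P * (A * B) = P * (B * A)" if "A \<in> M" "B \<in> M" for A B
  proof -
    have "S * (A * B - B * A) = 0"
      using S_ann ann[OF that] by simp
    then show ?thesis
      by (simp add: P_def mult.assoc right_diff_distrib)
  qed
  have comm_P: "(A * B) * P = (B * A) * P" if "A \<in> M" "B \<in> M" for A B
    using arg_cong[OF P_comm[of "adj A" "adj B"], of adj] that P(2) by simp
  have central: "A * P = P * A" if A: "A \<in> M" for A
  proof -
    have "P * A * P = P * A" if "A \<in> M" for A
      using P_comm[OF that P(1)] P(3) by (simp flip: mult.assoc)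
    then show ?thesis
      using A comm_P[OF A P(1)] P(3) by (simp add: mult.assoc)
  qed
  have "P = 0"
  proof (rule ccontr)
    assume "P \<noteq> 0"
    have P_in: "P \<in> {A * P |A. A \<in> M}"
      by (rule CollectI, rule exI[of _ 1]) simp
    have "central_projection M P"
      unfolding central_projection_def projection_def using P central by blast
    moreover have "abelian_projection {A * P |A. A \<in> M} P"
    proof -
      have compress: "P * (A * P) * P = A * P" if "A \<in> M" for A
        using central[OF that] P(3) by (metis mult.assoc)
      have "A * P * (B * P) = B * P * (A * P)" if "A \<in> M" "B \<in> M" for A B
      proof -
        have "A * P * (B * P) = A * B * P" if "A \<in> M" "B \<in> M" for A B
          using central[OF that(2)] P(3) by (metis mult.assoc)
        then show ?thesis
          using comm_P that by simp
      qed
      then show ?thesis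
        unfolding abelian_projection_def projection_def
        using P P_in by (auto simp: compress)
    qed
    moreover have "equivalent_projections {A * P |A. A \<in> M} P P"
      unfolding equivalent_projections_def using P by (intro bexI[OF _ P_in]) simp
    ultimately have "has_central_summand_type_I 1 M"
      using \<open>P \<noteq> 0\<close> unfolding has_central_summand_type_I_def type_I_def
      by (intro exI[of _ P]) (auto intro!: exI[of _ "\<lambda>_. P"])
    then show False
      using no_abelian by simp
  qed
  then have "S = 0"
    using adj_mult_self_eq_0[of S] S(2) by (simp add: P_def)
  have "complex_of_real c *\<^sub>C d = 0"
  proof (rule op_eqI)
    fix x :: 'a
    have "(norm (op_apply (complex_of_real c *\<^sub>C d) x))\<^sup>2 \<le> 0"
      using SD[of x] unfolding \<open>S = 0\<close> by (simp only: op_apply_simps(1) inner_zero_left)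
    then show "op_apply (complex_of_real c *\<^sub>C d) x = op_apply 0 x"
      by (simp only: power2_less_eq_zero_iff norm_eq_zero op_apply_simps(1))
  qed
  then show ?thesis
    using c by simp
qed

section \<open>Star-Lie maps and star-isomorphisms\<close>

context star_lie_bijection
begin

text \<open>
  The defect of additivity at self-adjoint arguments annihilates all commutators, so it vanishes.
  General arguments split into a self-adjoint and a skew part.
\<close>

lemma phi_additive:
  assumes no_abelian: "\<not> has_central_summand_type_I 1 M" and x: "x \<in> M" and y: "y \<in> M"
  shows "\<phi> (x + y) = \<phi> x + \<phi> y"
proof -
  have sa: "\<phi> (u + v) = \<phi> u + \<phi> v" if u: "u \<in> M" "adj u = u" and v: "v \<in> M" "adj v = v" for u v
  proof -
    have "\<phi> (u + v) - \<phi> u - \<phi> v = 0"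
    proof (rule commutator_annihilator_trivial[OF vN no_abelian])
      show "\<phi> (u + v) - \<phi> u - \<phi> v \<in> M" "adj (\<phi> (u + v) - \<phi> u - \<phi> v) = \<phi> (u + v) - \<phi> u - \<phi> v"
        using u v by (simp_all flip: phi_adj)
      show "(\<phi> (u + v) - \<phi> u - \<phi> v) * (A * B - B * A) = 0" if "A \<in> M" "B \<in> M" for A B
        using that by (intro commutator_annihilates_of_symmetries[OF vN symmetry_annihilates[OF u v]])
    qed
    then show ?thesis
      by (simp add: algebra_simps)
  qed
  have skew: "\<phi> (u + v) = \<phi> u + \<phi> v" if u: "u \<in> M" "adj u = - u" and v: "v \<in> M" "adj v = - v" for u v
  proof -
    have "\<i> *\<^sub>C \<phi> (u + v) = \<i> *\<^sub>C (\<phi> u + \<phi> v)"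
      using sa[of "\<i> *\<^sub>C u" "\<i> *\<^sub>C v"] u v by (simp add: scale flip: scaleC_add_right)
    then show ?thesis
      by simp
  qed
  have double: "\<phi> z + \<phi> z = \<phi> (z + adj z) + \<phi> (z - adj z)" if "z \<in> M" for z
    using that by (simp add: phi_real_part phi_imaginary_part)
  have "\<phi> (x + y) + \<phi> (x + y) =
      \<phi> ((x + adj x) + (y + adj y)) + \<phi> ((x - adj x) + (y - adj y))"
    using double[of "x + y"] x y by (simp add: algebra_simps)
  also have "\<dots> = (\<phi> (x + adj x) + \<phi> (y + adj y)) + (\<phi> (x - adj x) + \<phi> (y - adj y))"
    using x y sa[of "x + adj x" "y + adj y"] skew[of "x - adj x" "y - adj y"]
    by (simp add: add.commute)
  also have "\<dots> = (\<phi> x + \<phi> y) + (\<phi> x + \<phi> y)"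
    using double[OF x] double[OF y] by (simp add: algebra_simps)
  finally have "2 *\<^sub>C \<phi> (x + y) = 2 *\<^sub>C (\<phi> x + \<phi> y)"
    by (simp only: add_self_eq_scaleC)
  then show ?thesis
    by simp
qed

text \<open>
  The product \<open>2 x y\<close> is the sum of \<open>x y + y x\<^sup>*\<close> and \<open>x y - y x\<^sup>*\<close>, both of which \<open>\<phi>\<close> respects.
\<close>

lemma star_isomorphism_phi:
  assumes no_abelian: "\<not> has_central_summand_type_I 1 M"
  shows "star_isomorphism M M \<phi>"
proof -
  note add = phi_additive[OF no_abelian]
  have "\<phi> (x * y) = \<phi> x * \<phi> y" if x: "x \<in> M" and y: "y \<in> M" for x y
  proof -
    have "\<phi> (x * y) + \<phi> (x * y) = \<phi> ((x * y + y * adj x) + (x * y - y * adj x))"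
      using x y by (simp flip: add)
    also have "\<dots> = \<phi> (x * y + y * adj x) + \<phi> (star_commutator x y)"
      unfolding star_commutator_def using x y by (intro add) simp_all
    also have "\<dots> = \<phi> x * \<phi> y + \<phi> x * \<phi> y"
      using x y by (simp add: lie phi_star_jordan) (simp add: star_commutator_def)
    finally have "2 *\<^sub>C \<phi> (x * y) = 2 *\<^sub>C (\<phi> x * \<phi> y)"
      by (simp only: add_self_eq_scaleC)
    then show ?thesis
      by simp
  qed
  then show ?thesis
    using bij by (simp add: star_isomorphism_def add scale phi_adj)
qed

end

text \<open>
  Since \<open>\<i> 1\<close> is skew, the star-commutator of a multiple of it with \<open>1\<close> doubles it. So the first
  variables can be spent on a scalar, leaving a polynomial in two variables.
\<close>

lemma star_lie_poly_iterate:
  assumes "x (Suc 0) = \<i> *\<^sub>C 1" "\<And>i. 2 \<le> i \<Longrightarrow> i \<le> n \<Longrightarrow> x i = 1" "n \<ge> 1"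
  shows "star_lie_poly n x = (2 ^ (n - 1) * \<i>) *\<^sub>C 1"
  using assms(3,2)
proof (induction n rule: dec_induct)
  case base
  then show ?case using assms(1) by simp
next
  case (step n)
  then obtain m where m: "n = Suc m"
    by (cases n) auto
  show ?case
    using step by (simp add: m star_commutator_def flip: scaleC_add_left)
qed

text \<open>
  The skew scalar from the first \<open>m + 1\<close> variables multiplies \<open>- \<i> u\<close> into a positive multiple of
  \<open>u\<close>, and a positive factor can be pulled out of the star-commutator.
\<close>

lemma star_lie_poly_binary:
  assumes "x (Suc 0) = \<i> *\<^sub>C 1" "\<And>i. 2 \<le> i \<Longrightarrow> i \<le> Suc m \<Longrightarrow> x i = 1"
    and "x (Suc (Suc m)) = (- \<i>) *\<^sub>C u" "x (Suc (Suc (Suc m))) = v"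
  shows "star_lie_poly (Suc (Suc (Suc m))) x = (2 ^ Suc m) *\<^sub>C star_commutator u v"
proof -
  have "star_lie_poly (Suc m) x = (2 ^ m * \<i>) *\<^sub>C 1"
    using star_lie_poly_iterate[of x "Suc m"] assms by simp
  moreover have "\<i> * (2 ^ m * \<i>) = - (2 ^ m)" "2 ^ m * \<i> * \<i> = - (2 ^ m)"
    by (simp_all add: complex_eq_iff)
  ultimately have "star_lie_poly (Suc (Suc m)) x = (2 ^ m) *\<^sub>C u + (2 ^ m) *\<^sub>C u"
    by (simp add: star_commutator_def assms(3) scaleC_scaleC)
  also have "\<dots> = (2 ^ Suc m) *\<^sub>C u"
    by (simp flip: scaleC_add_left)
  finally show ?thesis
    by (simp add: star_commutator_def assms(4) scaleC.scale_right_diff_distrib)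
qed

lemma multiplicative_star_lie_map_imp_binary:
  fixes M :: "'a::complex_hilbert_space bounded_op set"
  assumes "n \<ge> 2" and vN: "von_neumann_algebra M" and unital: "\<phi> 1 = 1"
    and scale: "\<And>c A. A \<in> M \<Longrightarrow> \<phi> (c *\<^sub>C A) = c *\<^sub>C \<phi> A"
    and \<phi>: "multiplicative_star_lie_map n M \<phi>" and x: "x \<in> M" and y: "y \<in> M"
  shows "\<phi> (star_commutator x y) = star_commutator (\<phi> x) (\<phi> y)"
proof -
  note closed = von_neumann_algebra_closed[OF vN]
  have \<phi>_poly: "\<phi> (star_lie_poly n z) = star_lie_poly n (\<lambda>i. \<phi> (z i))" if "\<And>i. z i \<in> M" for z
    using \<phi> that by (simp add: multiplicative_star_lie_map_def)
  consider "n = Suc (Suc 0)" | m where "n = Suc (Suc (Suc m))"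
  proof -
    obtain k where "n = Suc (Suc k)"
      using \<open>n \<ge> 2\<close> by (auto simp: numeral_2_eq_2 Suc_le_eq dest!: less_imp_Suc_add)
    then show thesis
      using that by (cases k) auto
  qed
  then show ?thesis
  proof cases
    case 1
    then show ?thesis
      using \<phi>_poly[of "\<lambda>i. if i = 1 then x else y"] x y by simp
  next
    case (2 m)
    define z where "z i = (if i = Suc 0 then \<i> *\<^sub>C 1 else if i = Suc (Suc m) then (- \<i>) *\<^sub>C x
      else if i = Suc (Suc (Suc m)) then y else 1)" for i
    have "star_lie_poly n z = (2 ^ Suc m) *\<^sub>C star_commutator x y"
      unfolding 2 by (rule star_lie_poly_binary) (simp_all add: z_def)
    moreover have "star_lie_poly n (\<lambda>i. \<phi> (z i)) = (2 ^ Suc m) *\<^sub>C star_commutator (\<phi> x) (\<phi> y)"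
      unfolding 2 using x scale[OF closed(1)]
      by (intro star_lie_poly_binary) (simp_all add: z_def scale unital closed del: scaleC.scale_minus_left)
    moreover have "\<phi> (star_lie_poly n z) = star_lie_poly n (\<lambda>i. \<phi> (z i))"
      using x y by (intro \<phi>_poly) (simp add: z_def closed)
    moreover have "star_commutator x y \<in> M"
      using x y by (simp add: star_commutator_def closed)
    ultimately have "(2 ^ Suc m) *\<^sub>C \<phi> (star_commutator x y) = (2 ^ Suc m) *\<^sub>C star_commutator (\<phi> x) (\<phi> y)"
      by (simp only: scale)
    then show ?thesis
      by simp
  qed
qed

lemma star_isomorphism_imp_star_lie:
  fixes M :: "'a::complex_hilbert_space bounded_op set"
  assumes vN: "von_neumann_algebra M" and iso: "star_isomorphism M M \<phi>"
  shows "\<phi> 1 = 1" "multiplicative_star_lie_map n M \<phi>"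
proof -
  note closed = von_neumann_algebra_closed[OF vN]
  have bij: "bij_betw \<phi> M M"
    and add: "\<And>A B. A \<in> M \<Longrightarrow> B \<in> M \<Longrightarrow> \<phi> (A + B) = \<phi> A + \<phi> B"
    and scale: "\<And>c A. A \<in> M \<Longrightarrow> \<phi> (c *\<^sub>C A) = c *\<^sub>C \<phi> A"
    and mult: "\<And>A B. A \<in> M \<Longrightarrow> B \<in> M \<Longrightarrow> \<phi> (A * B) = \<phi> A * \<phi> B"
    and star: "\<And>A. A \<in> M \<Longrightarrow> \<phi> (adj A) = adj (\<phi> A)"
    using iso by (simp_all add: star_isomorphism_def)
  obtain e where e: "e \<in> M" "\<phi> e = 1"
    using bij closed(1) by (metis bij_betw_imp_surj_on imageE)
  then show "\<phi> 1 = 1"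
    using mult[OF closed(1) e(1)] by simp
  have zero: "\<phi> 0 = 0"
    using scale[OF closed(2), of 0] by simp
  have minus: "\<phi> (A - B) = \<phi> A - \<phi> B" if "A \<in> M" "B \<in> M" for A B
    using add[of "A - B" B] that closed(4) by (simp add: algebra_simps)
  have poly: "star_lie_poly k x \<in> M \<and> \<phi> (star_lie_poly k x) = star_lie_poly k (\<lambda>i. \<phi> (x i))"
    if "\<forall>i\<in>{1..k}. x i \<in> M" for k x
    using that
  proof (induction k x rule: star_lie_poly.induct)
    case (3 k x)
    then have "star_lie_poly (Suc k) x \<in> M"
      "\<phi> (star_lie_poly (Suc k) x) = star_lie_poly (Suc k) (\<lambda>i. \<phi> (x i))" "x (Suc (Suc k)) \<in> M"
      by simp_all
    then show ?case
      by (simp add: star_commutator_def closed minus mult star)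
  qed (simp_all add: zero closed)
  then show "multiplicative_star_lie_map n M \<phi>"
    by (simp add: multiplicative_star_lie_map_def)
qed

theorem corollary3p3:
  fixes n :: nat
    and M :: "'a::complex_hilbert_space bounded_op set"
    and \<phi> :: "'a bounded_op \<Rightarrow> 'a bounded_op"
  assumes "n \<ge> 2"
    and "von_neumann_algebra M"
    and "\<not> has_central_summand_type_I 1 M"
    and "\<phi> \<in> M \<rightarrow> M"
    and "preserves_complex_scaling M \<phi>"
  shows "(bij_betw \<phi> M M \<and> \<phi> 1 = 1 \<and> multiplicative_star_lie_map n M \<phi>)
    \<longleftrightarrow> star_isomorphism M M \<phi>"
proof
  assume \<phi>: "bij_betw \<phi> M M \<and> \<phi> 1 = 1 \<and> multiplicative_star_lie_map n M \<phi>"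
  have scale: "\<phi> (c *\<^sub>C A) = c *\<^sub>C \<phi> A" if "A \<in> M" for c A
    using assms(5) that by (simp add: preserves_complex_scaling_def)
  interpret star_lie_bijection M \<phi>
    using assms(2) \<phi> scale multiplicative_star_lie_map_imp_binary[OF assms(1,2) _ scale]
    by unfold_locales auto
  show "star_isomorphism M M \<phi>"
    by (rule star_isomorphism_phi[OF assms(3)])
next
  assume "star_isomorphism M M \<phi>"
  then show "bij_betw \<phi> M M \<and> \<phi> 1 = 1 \<and> multiplicative_star_lie_map n M \<phi>"
    using star_isomorphism_imp_star_lie[OF assms(2)] by (simp add: star_isomorphism_def)
qed

end
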